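(* For each integer $k \ge 1$ there is a bijection $\Omega_{\beta,k} : \mathcal{D} \to \mathcal{W}_{k+1}$ such that, for every $\lambda\in\mathcal{D}$, if $w = \Omega_{\beta,k}(\lambda)$ and $a_i$ denotes the number of occurrences of the letter $i$ in $w$, then: (1) $\lambda$ contains exactly $a_i$ parts congruent to $i$ modulo $k$, for each $1 \le i \le k$; (2) $|\lambda| = k\,\mathrm{comaj}_\beta(w) - \sum_{i=1}^{k-1} (k-i)\,a_i$; (3) $\mu_k(\lambda) = \mathrm{asc}_\beta(w)$.
   Context: A partition is a weakly decreasing sequence $\lambda=(\lambda_1,\lambda_2,\ldots)$ of nonnegative integers with finite sum $|\lambda| = \sum_i \lambda_i$; its nonzero entries are its parts. $\mathcal{D}$ is the set of partitions whose parts are pairwise distinct (including the empty partition). The $k$-measure $\mu_k(\lambda)$ is the maximal length $m$ of a sequence of indices $i_1<\cdots<i_m$ of parts (nonzero entries) of $\lambda$ such that $\lambda_{i_j}-\lambda_{i_{j+1}} \ge k$ for all $1\le j<m$ (so $\mu_k$ of the empty partition is $0$). $\mathcal{W}_{k+1}$ is the set of finite words $w=w_1\cdots w_n$ ($n\ge 1$) on the alphabet $\{1,\ldots,k+1\}$ that end with a single $k+1$, i.e. $w_n = k+1$ and, if $n\ge 2$, $w_{n-1}\ne k+1$. A $\beta$-ascent of $w=w_1\cdots w_n\in\mathcal{W}_{k+1}$ is an index $1\le i<n$ such that either $w_i<w_{i+1}$ or $w_i=w_{i+1}<k+1$. $\mathrm{asc}_\beta(w)$ is the number of $\beta$-ascents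 of $w$ and $\mathrm{comaj}_\beta(w)$ is the sum of all $\beta$-ascents of $w$. *)

theory Defs
  imports "HOL-Number_Theory.Cong"
begin

text \<open>
  A partition \<open>\<lambda> = (\<lambda>\<^sub>1, \<lambda>\<^sub>2, \<dots>)\<close> is a function on \<open>nat\<close> whose value at \<open>i\<close> is
  \<open>\<lambda>\<^sub>i\<^sub>+\<^sub>1\<close>. For a sequence of natural numbers, having a finite sum means having
  only finitely many nonzero entries.
\<close>

definition part_indices :: "(nat \<Rightarrow> nat) \<Rightarrow> nat set" where
  "part_indices l = {i. l i \<noteq> 0}"

definition is_partition :: "(nat \<Rightarrow> nat) \<Rightarrow> bool" where
  "is_partition l \<longleftrightarrow> antimono l \<and> finite (part_indices l)"

definition psize :: "(nat \<Rightarrow> nat) \<Rightarrow> nat" where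
  "psize l = (\<Sum>i\<in>part_indices l. l i)"

definition distinct_partitions :: "(nat \<Rightarrow> nat) set" where
  "distinct_partitions = {l. is_partition l \<and> inj_on l (part_indices l)}"

text \<open>
  The inequality \<open>\<lambda>\<^sub>i - \<lambda>\<^sub>j \<ge> k\<close> is written additively to avoid truncated subtraction.
  The set below is nonempty (it contains the length of the empty sequence), and it is
  finite if \<open>l\<close> is a partition.
\<close>

definition k_measure :: "nat \<Rightarrow> (nat \<Rightarrow> nat) \<Rightarrow> nat" where
  "k_measure k l = Max {length is | is.
     sorted_wrt (<) is \<and> set is \<subseteq> part_indices l \<and>
     (\<forall>j. Suc j < length is \<longrightarrow> l (is ! j) \<ge> l (is ! Suc j) + k)}"

text \<open>
  \<open>words m\<close> is \<open>\<W>\<^sub>m\<close>, so \<open>m\<close> is the largest letter (the \<open>k + 1\<close> of \<open>\<W>\<^sub>k\<^sub>+\<^sub>1\<close>).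
  Lists are indexed from 0: the letter \<open>w\<^sub>i\<close> is \<open>w ! (i - 1)\<close>.
\<close>

definition words :: "nat \<Rightarrow> nat list set" where
  "words m = {w. length w \<ge> 1 \<and> set w \<subseteq> {1..m} \<and> w ! (length w - 1) = m \<and>
     (length w \<ge> 2 \<longrightarrow> w ! (length w - 2) \<noteq> m)}"

definition beta_ascents :: "nat \<Rightarrow> nat list \<Rightarrow> nat set" where
  "beta_ascents m w = {i. 1 \<le> i \<and> i < length w \<and>
     (w ! (i - 1) < w ! i \<or> (w ! (i - 1) = w ! i \<and> w ! i < m))}"

definition asc_beta :: "nat \<Rightarrow> nat list \<Rightarrow> nat" where
  "asc_beta m w = card (beta_ascents m w)"

definition comaj_beta :: "nat \<Rightarrow> nat list \<Rightarrow> nat" where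
  "comaj_beta m w = \<Sum>(beta_ascents m w)"

end

theory Submission
  imports Defs "HOL-Library.Multiset" "HOL-Library.Equipollence"
begin

text \<open>
  Give a distinct partition \<open>\<lambda>\<close>, identified with its set \<open>S\<close> of parts, the weight consisting of
  \<open>\<mu>\<^sub>k(\<lambda>)\<close>, of \<open>|\<lambda>| + \<Sum>(k - i) a\<^sub>i\<close> and of the multiset of residues of the parts modulo \<open>k\<close>; give a
  word \<open>w\<close> the weight consisting of \<open>asc\<^sub>\<beta>(w)\<close>, of \<open>k comaj\<^sub>\<beta>(w)\<close> and of the multiset of residues of
  its letters other than \<open>k + 1\<close>. The wanted bijection is one that preserves weights. It exists as
  soon as every weight is attained equally often on both sides.

  The two counts become comparable after both sides are multiplied by the same set of surplus pairs
  \<open>(M, E)\<close>, where \<open>E\<close> is a finite multiset of numbers in \<open>{1..M}\<close>: such a pair adds \<open>M\<close> to the first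
  component of the weight and \<open>k \<Sum>E\<close> to the second. Both products turn out to have the same weights
  as the triples \<open>(M, E, S)\<close> with \<open>E\<close> as before and \<open>S \<subseteq> {1..k M}\<close>. In terms of generating functions,
  with \<open>x\<close> marking the first component, \<open>q\<close> marking \<open>k\<close> units of size, \<open>t\<^sub>j\<close> marking a part \<open>j\<close>
  (so that \<open>t\<^sub>j\<^sub>+\<^sub>k = q t\<^sub>j\<close>), and \<open>(x; q)\<close> and \<open>(q)\<^sub>M\<close> denoting the infinite and the finite \<open>q\<close>-products,
  both sides equal \<open>(x; q) \<Sum>\<^sub>M x\<^sup>M / (q)\<^sub>M \<Prod>\<^sub>1\<^sub>\<le>\<^sub>j\<^sub>\<le>\<^sub>k\<^sub>M (1 + t\<^sub>j)\<close>.

  For partitions, a longest sequence of parts with gaps at least \<open>k\<close> can be chosen greedily from the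
  smallest part upwards. So the generating function \<open>G\<^sub>p\<close> of the partitions with all parts at least
  \<open>p\<close> satisfies \<open>G\<^sub>p = G\<^sub>p\<^sub>+\<^sub>1 + x t\<^sub>p (1 + t\<^sub>p\<^sub>+\<^sub>1) \<dots> (1 + t\<^sub>p\<^sub>+\<^sub>k\<^sub>-\<^sub>1) G\<^sub>p\<^sub>+\<^sub>k\<close>: either \<open>p\<close> is not a part, or it
  is the first chosen part and the next \<open>k - 1\<close> numbers are free. The sum over \<open>M\<close>, with the product
  started at \<open>p\<close>, satisfies the same recursion, because a part \<open>p\<close> can be traded against a part
  \<open>p + k M\<close> and an element \<open>M\<close> of \<open>E\<close>. This is \<open>windowed_eqpoll_measured\<close>.

  For words, the argument is MacMahon's: continue \<open>w\<close> by infinitely many letters \<open>k + 1\<close>, and let the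
  level of a position be the number of ascents after it. Then \<open>comaj\<^sub>\<beta>(w)\<close> is the sum of the levels.
  Adding a partition with largest part at most \<open>M\<close> to the levels gives all weakly decreasing
  sequences of levels that drop strictly at each ascent. The pairs (level, letter) of such a sequence
  are in lexicographically decreasing order, and only pairs with letter \<open>k + 1\<close> may be repeated. So the
  sequence amounts to a multiset of pairs; the pairs with letter \<open>k + 1\<close> form \<open>E\<close>, the others form \<open>S\<close>.
  This is the chain of equivalences that ends in \<open>windowed_eqpoll_semistrict_msets\<close>.

  Finally the surplus pairs are cancelled. The only one with \<open>M = 0\<close> is \<open>(0, {#})\<close>, so an induction on
  the first component of the weight subtracts the contributions of all other pairs, see
  \<open>eqpoll_cancel_surplus\<close>.
\<close>

section \<open>Equipollence of weighted sets\<close>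

lemma eqpoll_byWitness:
  assumes "\<And>x. x \<in> A \<Longrightarrow> f x \<in> B" "\<And>y. y \<in> B \<Longrightarrow> g y \<in> A"
    and "\<And>x. x \<in> A \<Longrightarrow> g (f x) = x" "\<And>y. y \<in> B \<Longrightarrow> f (g y) = y"
  shows "A \<approx> B"
  unfolding eqpoll_iff_bijections using assms by blast

lemma eqpoll_split:
  assumes "{x \<in> A. P x} \<approx> {y \<in> B. Q y}" "{x \<in> A. \<not> P x} \<approx> {y \<in> B. \<not> Q y}"
  shows "A \<approx> B"
proof -
  have "{x \<in> A. P x} \<union> {x \<in> A. \<not> P x} \<approx> {y \<in> B. Q y} \<union> {y \<in> B. \<not> Q y}"
    by (rule Un_eqpoll_cong[OF assms]) (auto simp: disjnt_def)
  moreover have "{x \<in> A. P x} \<union> {x \<in> A. \<not> P x} = A" "{y \<in> B. Q y} \<union> {y \<in> B. \<not> Q y} = B" by auto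
  ultimately show ?thesis by simp
qed

lemma eqpoll_restrict:
  assumes "bij_betw f A B"
  shows "{x \<in> A. P (f x)} \<approx> {y \<in> B. P y}"
proof -
  have "bij_betw f {x \<in> A. P (f x)} {y \<in> B. P y}"
    using assms unfolding bij_betw_def inj_on_def by blast
  then show ?thesis unfolding eqpoll_def by blast
qed

lemma bij_of_eqpoll_fibres:
  assumes "\<And>c. {x \<in> A. u x = c} \<approx> {y \<in> B. v y = c}"
  shows "\<exists>f. bij_betw f A B \<and> (\<forall>x\<in>A. v (f x) = u x)"
proof -
  obtain h where h: "\<And>c. bij_betw (h c) {x \<in> A. u x = c} {y \<in> B. v y = c}"
    using assms unfolding eqpoll_def by metis
  define f where "f x = h (u x) x" for x
  have f: "f x \<in> B \<and> v (f x) = u x" if "x \<in> A" for x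
    using bij_betwE[OF h[of "u x"]] that by (auto simp: f_def)
  have "bij_betw f A B"
    unfolding bij_betw_def
  proof
    show "inj_on f A"
    proof (rule inj_onI)
      fix x y assume xy: "x \<in> A" "y \<in> A" "f x = f y"
      then have "u x = u y" using f by metis
      then show "x = y"
        using bij_betw_imp_inj_on[OF h[of "u x"]] xy by (auto simp: f_def inj_on_def)
    qed
    have "y \<in> f ` A" if "y \<in> B" for y
    proof -
      have "y \<in> h (v y) ` {x \<in> A. u x = v y}"
        using bij_betw_imp_surj_on[OF h[of "v y"]] that by blast
      then obtain x where "x \<in> A" "u x = v y" "y = h (v y) x" by blast
      then have "y = f x" by (simp add: f_def)
      then show ?thesis using \<open>x \<in> A\<close> by blast
    qed
    then show "f ` A = B" using f by blast
  qed
  then show ?thesis using f by blast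
qed

text \<open>
  If \<open>A\<close> and \<open>B\<close> have equally large fibres after multiplication by \<open>Y\<close>, then so they have before,
  provided that \<open>Y\<close> has exactly one element \<open>z\<close> of first weight 0: the fibre of the product is the
  disjoint union over \<open>y \<in> Y\<close> of fibres of the factor, those with \<open>y \<noteq> z\<close> belong to a smaller first
  weight, and the one with \<open>y = z\<close> is the fibre in question.
\<close>
lemma eqpoll_cancel_surplus:
  fixes \<alpha> \<beta> :: "'a \<Rightarrow> nat" and \<alpha>' \<beta>' :: "'b \<Rightarrow> nat" and \<mu> \<nu> :: "'y \<Rightarrow> nat"
    and \<gamma> :: "'a \<Rightarrow> 'c" and \<gamma>' :: "'b \<Rightarrow> 'c"
  assumes finY: "\<And>m n. finite {y \<in> Y. \<mu> y \<le> m \<and> \<nu> y \<le> n}"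
    and z: "z \<in> Y" "\<mu> z = 0" "\<nu> z = 0" "\<And>y. y \<in> Y \<Longrightarrow> \<mu> y = 0 \<Longrightarrow> y = z"
    and finA: "\<And>m n c. finite {x \<in> A. \<alpha> x = m \<and> \<beta> x = n \<and> \<gamma> x = c}"
    and eq: "\<And>m n c. {(x, y). x \<in> A \<and> y \<in> Y \<and> \<alpha> x + \<mu> y = m \<and> \<beta> x + \<nu> y = n \<and> \<gamma> x = c}
      \<approx> {(x, y). x \<in> B \<and> y \<in> Y \<and> \<alpha>' x + \<mu> y = m \<and> \<beta>' x + \<nu> y = n \<and> \<gamma>' x = c}"
  shows "{x \<in> A. \<alpha> x = m \<and> \<beta> x = n \<and> \<gamma> x = c} \<approx> {x \<in> B. \<alpha>' x = m \<and> \<beta>' x = n \<and> \<gamma>' x = c}"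
proof -
  define FA where "FA m n c y = {x \<in> A. \<alpha> x + \<mu> y = m \<and> \<beta> x + \<nu> y = n \<and> \<gamma> x = c}" for m n c y
  define FB where "FB m n c y = {x \<in> B. \<alpha>' x + \<mu> y = m \<and> \<beta>' x + \<nu> y = n \<and> \<gamma>' x = c}" for m n c y
  define Yc where "Yc m n = {y \<in> Y. \<mu> y \<le> m \<and> \<nu> y \<le> n}" for m n
  have finYc: "finite (Yc m n)" for m n unfolding Yc_def by (rule finY)
  have zc: "z \<in> Yc m n" for m n using z(1-3) by (simp add: Yc_def)
  have FA_shift: "FA m n c y = FA (m - \<mu> y) (n - \<nu> y) c z" if "y \<in> Yc m n" for m n c y
    using that z(1-3) by (auto simp: FA_def Yc_def)
  have FB_shift: "FB m n c y = FB (m - \<mu> y) (n - \<nu> y) c z" if "y \<in> Yc m n" for m n c y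
    using that z(1-3) by (auto simp: FB_def Yc_def)
  have finFA: "finite (FA m n c y)" if "y \<in> Yc m n" for m n c y
    unfolding FA_shift[OF that] using finA z(1-3) by (simp add: FA_def)
  have SA: "Sigma (Yc m n) (FA m n c) \<approx>
      {(x, y). x \<in> A \<and> y \<in> Y \<and> \<alpha> x + \<mu> y = m \<and> \<beta> x + \<nu> y = n \<and> \<gamma> x = c}" for m n c
    by (rule eqpoll_byWitness[where f = prod.swap and g = prod.swap]) (auto simp: Yc_def FA_def)
  have SB: "Sigma (Yc m n) (FB m n c) \<approx>
      {(x, y). x \<in> B \<and> y \<in> Y \<and> \<alpha>' x + \<mu> y = m \<and> \<beta>' x + \<nu> y = n \<and> \<gamma>' x = c}" for m n c
    by (rule eqpoll_byWitness[where f = prod.swap and g = prod.swap]) (auto simp: Yc_def FB_def)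
  have S: "Sigma (Yc m n) (FA m n c) \<approx> Sigma (Yc m n) (FB m n c)" for m n c
    using SA eq SB by (meson eqpoll_sym eqpoll_trans)
  have finS: "finite (Sigma (Yc m n) (FB m n c))" for m n c
    using eqpoll_finite_iff[OF S] finYc finFA by blast
  have finFB: "finite (FB m n c y)" if "y \<in> Yc m n" for m n c y
  proof (rule finite_subset)
    show "FB m n c y \<subseteq> snd ` Sigma (Yc m n) (FB m n c)" using that by force
    show "finite (snd ` Sigma (Yc m n) (FB m n c))" using finS by simp
  qed
  have sum_eq: "(\<Sum>y\<in>Yc m n. card (FA m n c y)) = (\<Sum>y\<in>Yc m n. card (FB m n c y))" for m n c
  proof -
    have "card (Sigma (Yc m n) (FA m n c)) = card (Sigma (Yc m n) (FB m n c))"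
      using S by (meson bij_betw_same_card eqpoll_def)
    then show ?thesis using finYc finFA finFB by (simp add: card_SigmaI)
  qed
  have "card (FA m n c z) = card (FB m n c z)" for n
  proof (induction m arbitrary: n rule: less_induct)
    case (less m)
    have "(\<Sum>y\<in>Yc m n - {z}. card (FA m n c y)) = (\<Sum>y\<in>Yc m n - {z}. card (FB m n c y))"
    proof (rule sum.cong[OF refl])
      fix y assume y: "y \<in> Yc m n - {z}"
      then have "\<mu> y \<noteq> 0" "\<mu> y \<le> m" using z(4) by (auto simp: Yc_def)
      then have "card (FA (m - \<mu> y) (n - \<nu> y) c z) = card (FB (m - \<mu> y) (n - \<nu> y) c z)"
        by (intro less.IH) simp
      then show "card (FA m n c y) = card (FB m n c y)" using FA_shift FB_shift y by simp
    qed
    then show ?case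
      using sum_eq[of m n c] finYc[of m n] zc[of m n] by (simp add: sum.remove[of _ z])
  qed
  then have "FA m n c z \<approx> FB m n c z"
    using finFA[OF zc] finFB[OF zc] by (simp add: eqpoll_iff_card)
  then show ?thesis using z(1-3) by (simp add: FA_def FB_def)
qed

section \<open>Partitions and multisets of positive numbers\<close>

lemma psize_eq_sum:
  assumes "\<And>i. i \<ge> n \<Longrightarrow> l i = 0"
  shows "psize l = (\<Sum>i<n. l i)"
  unfolding psize_def part_indices_def
proof (rule sum.mono_neutral_left)
  show "{i. l i \<noteq> 0} \<subseteq> {..<n}"
  proof
    fix i assume "i \<in> {i. l i \<noteq> 0}"
    then show "i \<in> {..<n}" using assms[of i] by (cases "n \<le> i") auto
  qed
qed auto

lemma antimono_Suc_iff: "antimono (l :: nat \<Rightarrow> nat) \<longleftrightarrow> (\<forall>i. l (Suc i) \<le> l i)"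
  by (rule antimono_iff_le_Suc)

lemma is_partition_iff: "is_partition l \<longleftrightarrow> (\<forall>i. l (Suc i) \<le> l i) \<and> (\<exists>n. \<forall>i\<ge>n. l i = 0)"
proof -
  have "finite (part_indices l) \<longleftrightarrow> (\<exists>n. \<forall>i\<ge>n. l i = 0)"
    unfolding part_indices_def finite_nat_set_iff_bounded by (metis (mono_tags, lifting) leD leI mem_Collect_eq)
  then show ?thesis by (simp add: is_partition_def antimono_Suc_iff)
qed

lemma partition_add:
  assumes "is_partition a" "is_partition b"
  shows "is_partition (\<lambda>i. a i + b i)" "psize (\<lambda>i. a i + b i) = psize a + psize b"
proof -
  obtain na where na: "\<And>i. i \<ge> na \<Longrightarrow> a i = 0" using assms(1) by (auto simp: is_partition_iff)
  obtain nb where nb: "\<And>i. i \<ge> nb \<Longrightarrow> b i = 0" using assms(2) by (auto simp: is_partition_iff)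
  let ?n = "max na nb"
  have "\<forall>i\<ge>?n. a i + b i = 0" using na nb by simp
  moreover have "\<forall>i. a (Suc i) + b (Suc i) \<le> a i + b i"
    using assms by (auto simp: is_partition_iff intro: add_mono)
  ultimately show "is_partition (\<lambda>i. a i + b i)" unfolding is_partition_iff by blast
  have "psize (\<lambda>i. a i + b i) = (\<Sum>i<?n. a i + b i)" by (rule psize_eq_sum) (use na nb in auto)
  moreover have "psize a = (\<Sum>i<?n. a i)" by (rule psize_eq_sum) (use na in auto)
  moreover have "psize b = (\<Sum>i<?n. b i)" by (rule psize_eq_sum) (use nb in auto)
  ultimately show "psize (\<lambda>i. a i + b i) = psize a + psize b" by (simp add: sum.distrib)
qed

text \<open>
  A partition that decreases at each index at least as much as the partition \<open>c\<close> dominates \<open>c\<close>, and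
  the difference is again a partition: both claims propagate downwards from the indices where \<open>c\<close> has
  become 0.
\<close>
lemma partition_diff:
  assumes "is_partition f" "\<And>i. c i = c (Suc i) + d i" "\<And>i. f i \<ge> f (Suc i) + d i"
    and "is_partition c"
  shows "c i \<le> f i" "is_partition (\<lambda>i. f i - c i)"
proof -
  obtain n where n: "\<And>i. i \<ge> n \<Longrightarrow> c i = 0" using assms(4) by (auto simp: is_partition_iff)
  \<comment> \<open>Beyond \<open>n\<close> the claim is trivial, so the induction runs downwards from there.\<close>
  have le: "c i \<le> f i" for i
  proof (induction "n - i" arbitrary: i)
    case 0
    then show ?case using n by simp
  next
    case (Suc x)
    then have "c (Suc i) \<le> f (Suc i)" by simp
    then show ?case using assms(2,3)[of i] by linarith
  qed
  then show "c i \<le> f i" .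
  obtain n' where n': "\<And>i. i \<ge> n' \<Longrightarrow> f i = 0" using assms(1) by (auto simp: is_partition_iff)
  have "f (Suc i) - c (Suc i) \<le> f i - c i" for i
    using assms(2,3)[of i] le[of i] le[of "Suc i"] by linarith
  moreover have "\<forall>i\<ge>n'. f i - c i = 0" using n' by simp
  ultimately show "is_partition (\<lambda>i. f i - c i)" unfolding is_partition_iff by blast
qed

definition parts_mset :: "(nat \<Rightarrow> nat) \<Rightarrow> nat multiset" where
  "parts_mset l = image_mset l (mset_set (part_indices l))"

lemma sum_parts_mset: "\<Sum>\<^sub># (parts_mset l) = psize l"
  by (simp add: parts_mset_def psize_def sum_unfold_sum_mset)

text \<open>
  Since a partition is weakly decreasing, its parts of size at least \<open>v\<close> occupy an initial segment of
  the indices. The length of that segment can be read off from the multiset of parts, so the multiset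
  determines the partition.
\<close>
lemma size_filter_parts_mset:
  assumes "is_partition l" "v \<ge> 1"
  shows "{i. v \<le> l i} = {..<size {#x \<in># parts_mset l. v \<le> x#}}"
proof -
  have fin: "finite (part_indices l)" and anti: "antimono l"
    using assms by (auto simp: is_partition_def)
  let ?J = "{i. v \<le> l i}"
  have finJ: "finite ?J"
    by (rule finite_subset[OF _ fin]) (use assms in \<open>auto simp: part_indices_def\<close>)
  have "{#x \<in># parts_mset l. v \<le> x#} = image_mset l (mset_set {i \<in> part_indices l. v \<le> l i})"
    using fin by (simp add: parts_mset_def filter_mset_image_mset)
  also have "{i \<in> part_indices l. v \<le> l i} = ?J"
    using assms by (auto simp: part_indices_def)
  finally have size: "size {#x \<in># parts_mset l. v \<le> x#} = card ?J"
    using finJ by simp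
  have down: "j \<in> ?J" if "i \<in> ?J" "j \<le> i" for i j
    using antimonoD[OF anti \<open>j \<le> i\<close>] that by auto
  have "?J = {..<card ?J}"
  proof (cases "?J = {}")
    case False
    have "?J = {..Max ?J}"
      using down[OF Max_in[OF finJ False]] Max_ge[OF finJ] by blast
    then show ?thesis by (metis card_atMost lessThan_Suc_atMost)
  qed (metis (no_types, lifting) card.empty lessThan_0)
  with size show ?thesis by simp
qed

lemma partition_eqI:
  assumes "is_partition l" "is_partition l'" "parts_mset l = parts_mset l'"
  shows "l = l'"
proof
  fix i
  have "v \<le> l i \<longleftrightarrow> v \<le> l' i" for v
  proof (cases "v = 0")
    case False
    then show ?thesis
      using size_filter_parts_mset[OF assms(1), of v] size_filter_parts_mset[OF assms(2), of v] assms(3)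
      by (auto simp: set_eq_iff)
  qed simp
  then show "l i = l' i" by (metis order.antisym order.refl)
qed

lemma partition_with_parts:
  assumes "0 \<notin># A"
  shows "\<exists>l. is_partition l \<and> parts_mset l = A"
proof -
  define xs where "xs = rev (sorted_list_of_multiset A)"
  define l where "l i = (if i < length xs then xs ! i else 0)" for i
  have ms: "mset xs = A" by (simp add: xs_def)
  have pos: "xs ! i \<noteq> 0" if "i < length xs" for i
    using assms that by (metis ms nth_mem_mset)
  have sorted: "sorted_wrt (\<ge>) xs"
    by (simp add: xs_def sorted_wrt_rev)
  have idx: "part_indices l = {..<length xs}"
    using pos by (auto simp: part_indices_def l_def)
  have "antimono l"
    by (rule antimonoI) (use sorted in \<open>auto simp: l_def sorted_wrt_iff_nth_less le_less\<close>)
  then have "is_partition l" by (simp add: is_partition_def idx)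
  moreover have "parts_mset l = A"
  proof -
    have "parts_mset l = image_mset (\<lambda>i. xs ! i) (mset_set {..<length xs})"
      unfolding parts_mset_def idx by (rule image_mset_cong) (simp add: l_def)
    also have "\<dots> = mset (map (\<lambda>i. xs ! i) [0..<length xs])"
      by (simp add: lessThan_atLeast0)
    finally show ?thesis using ms by (simp add: map_nth)
  qed
  ultimately show ?thesis by blast
qed

lemma bij_parts_mset: "bij_betw parts_mset {l. is_partition l} {A. 0 \<notin># A}"
  unfolding bij_betw_def
proof
  show "inj_on parts_mset {l. is_partition l}"
    by (auto intro: inj_onI partition_eqI)
  have "0 \<notin># parts_mset l" if "is_partition l" for l
    using that by (auto simp: parts_mset_def is_partition_def part_indices_def)
  then show "parts_mset ` {l. is_partition l} = {A. 0 \<notin># A}"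
    using partition_with_parts by (fastforce simp: image_iff)
qed

definition parts :: "(nat \<Rightarrow> nat) \<Rightarrow> nat set" where
  "parts l = l ` part_indices l"

lemma parts_mset_distinct:
  assumes "l \<in> distinct_partitions"
  shows "parts_mset l = mset_set (parts l)"
  using assms by (simp add: distinct_partitions_def parts_def parts_mset_def image_mset_mset_set)

lemma set_parts_mset: "is_partition l \<Longrightarrow> set_mset (parts_mset l) = parts l"
  by (simp add: parts_mset_def parts_def is_partition_def)

lemma bij_parts: "bij_betw parts distinct_partitions {S. finite S \<and> 0 \<notin> S}"
  unfolding bij_betw_def
proof
  show "inj_on parts distinct_partitions"
    by (rule inj_onI) (metis (mono_tags, lifting) distinct_partitions_def mem_Collect_eq
      parts_mset_distinct partition_eqI)
  have "\<exists>l \<in> distinct_partitions. parts l = S" if S: "finite S" "0 \<notin> S" for S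
  proof -
    obtain l where l: "is_partition l" "parts_mset l = mset_set S"
      using partition_with_parts[of "mset_set S"] S by auto
    have fin: "finite (part_indices l)" using l(1) by (simp add: is_partition_def)
    have PS: "parts l = S" using set_parts_mset[OF l(1)] l(2) S by simp
    have "card (l ` part_indices l) = card (part_indices l)"
      using arg_cong[OF l(2), of size] PS by (simp add: parts_mset_def parts_def)
    then have "inj_on l (part_indices l)" using fin by (rule eq_card_imp_inj_on[rotated])
    with l PS show ?thesis by (auto simp: distinct_partitions_def)
  qed
  moreover have "finite (parts l) \<and> 0 \<notin> parts l" if "l \<in> distinct_partitions" for l
    using that by (auto simp: distinct_partitions_def is_partition_def parts_def part_indices_def)
  ultimately show "parts ` distinct_partitions = {S. finite S \<and> 0 \<notin> S}"
    by blast
qed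

lemma filter_parts_mset:
  assumes "is_partition y" "\<And>x. P x \<Longrightarrow> x \<noteq> 0"
  shows "filter_mset P (parts_mset y) = image_mset y (mset_set {i. P (y i)})"
proof -
  have "filter_mset P (parts_mset y) = image_mset y (mset_set {i \<in> part_indices y. P (y i)})"
    using assms(1) by (simp add: parts_mset_def filter_mset_image_mset is_partition_def)
  also have "{i \<in> part_indices y. P (y i)} = {i. P (y i)}"
    using assms(2) by (auto simp: part_indices_def)
  finally show ?thesis .
qed

lemma parts_mset_bound:
  assumes "is_partition y"
  shows "set_mset (parts_mset y) \<subseteq> {1..N} \<longleftrightarrow> y 0 \<le> N"
proof -
  have anti: "y i \<le> y 0" for i using assms by (auto simp: is_partition_def intro: antimonoD)
  show ?thesis
  proof
    assume "set_mset (parts_mset y) \<subseteq> {1..N}"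
    then show "y 0 \<le> N"
      by (cases "y 0 = 0") (auto simp: set_parts_mset[OF assms] parts_def part_indices_def)
  next
    assume "y 0 \<le> N"
    then show "set_mset (parts_mset y) \<subseteq> {1..N}"
      using order_trans[OF anti] by (auto simp: set_parts_mset[OF assms] parts_def part_indices_def)
  qed
qed

text \<open>
  Equal values of a weakly decreasing sequence are adjacent, so a repetition can be detected by
  comparing neighbours.
\<close>
lemma count_parts_mset_le_1:
  assumes "is_partition y" "x \<noteq> 0"
  shows "count (parts_mset y) x \<le> 1 \<longleftrightarrow> (\<forall>i. y i = x \<longrightarrow> y (Suc i) < y i)"
proof -
  have anti: "antimono y" using assms by (simp add: is_partition_def)
  have "finite {i. y i = x}"
    by (rule finite_subset[of _ "part_indices y"]) (use assms in \<open>auto simp: is_partition_def part_indices_def\<close>)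
  moreover have "{#z \<in># parts_mset y. z = x#} = image_mset y (mset_set {i. y i = x})"
    by (rule filter_parts_mset[OF assms(1)]) (use assms(2) in simp)
  then have "count (parts_mset y) x = card {i. y i = x}"
    by (metis filter_eq_replicate_mset size_image_mset size_mset_set size_replicate_mset)
  ultimately have "count (parts_mset y) x \<le> 1 \<longleftrightarrow> (\<forall>i j. y i = x \<longrightarrow> y j = x \<longrightarrow> i = j)"
    using card_le_Suc0_iff_eq[of "{i. y i = x}"] by auto
  also have "\<dots> \<longleftrightarrow> (\<forall>i. y i = x \<longrightarrow> y (Suc i) < y i)"
  proof (intro iffI allI impI)
    fix i assume inj: "\<forall>i j. y i = x \<longrightarrow> y j = x \<longrightarrow> i = j" and "y i = x"
    then have "y (Suc i) \<noteq> y i" by (metis n_not_Suc_n)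
    moreover have "y (Suc i) \<le> y i" using anti by (simp add: antimonoD)
    ultimately show "y (Suc i) < y i" by simp
  next
    fix i j assume strict: "\<forall>i. y i = x \<longrightarrow> y (Suc i) < y i" and ij: "y i = x" "y j = x"
    \<comment> \<open>Between two occurrences of \<open>x\<close> the sequence would have to be constant.\<close>
    have no: False if "a < b" "y a = x" "y b = x" for a b
    proof -
      have "y b \<le> y (Suc a)" using anti that(1) by (simp add: antimonoD)
      then show False using strict that by force
    qed
    show "i = j" using no[of i j] no[of j i] ij by (cases i j rule: linorder_cases) auto
  qed
  finally show ?thesis .
qed

section \<open>The measure of a finite set\<close>

definition separated :: "nat \<Rightarrow> nat set \<Rightarrow> bool" where
  "separated k T \<longleftrightarrow> (\<forall>x\<in>T. \<forall>y\<in>T. x < y \<longrightarrow> x + k \<le> y)"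

text \<open>
  This is \<open>k_measure\<close> as a function of the set of parts, see \<open>k_measure_eq_separation\<close>.
\<close>
definition separation :: "nat \<Rightarrow> nat set \<Rightarrow> nat" where
  "separation k S = Max (card ` {T. T \<subseteq> S \<and> separated k T})"

lemma separation_ge:
  assumes "finite S" "T \<subseteq> S" "separated k T"
  shows "card T \<le> separation k S"
  unfolding separation_def using assms by (intro Max_ge) auto

lemma separation_obtain:
  assumes "finite S"
  obtains T where "T \<subseteq> S" "separated k T" "card T = separation k S"
proof -
  have "{} \<in> {T. T \<subseteq> S \<and> separated k T}" by (simp add: separated_def)
  then have "separation k S \<in> card ` {T. T \<subseteq> S \<and> separated k T}"
    unfolding separation_def using assms by (intro Max_in) auto
  then show ?thesis using that by auto
qed

lemma separation_empty [simp]: "separation k {} = 0"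
  by (metis separation_obtain[of "{}" k] card.empty finite.emptyI subset_empty)

text \<open>
  Greedy choice from below: in a separated set, the least element can be replaced by \<open>p\<close>, the least
  element available. The others are at least \<open>k\<close> larger than the one replaced, hence at least
  \<open>p + k\<close>.
\<close>
lemma separation_rec:
  assumes "finite S" "p \<in> S" "k \<ge> 1"
  shows "separation k (S \<inter> {p..}) = Suc (separation k (S \<inter> {p + k..}))"
proof (rule antisym)
  obtain T where T: "T \<subseteq> S \<inter> {p..}" "separated k T" "card T = separation k (S \<inter> {p..})"
    using separation_obtain[of "S \<inter> {p..}" k] assms by auto
  have finT: "finite T" using T(1) assms(1) by (meson finite_Int finite_subset)
  show "separation k (S \<inter> {p..}) \<le> Suc (separation k (S \<inter> {p + k..}))"
  proof (cases "T = {}")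
    case False
    define x where "x = Min T"
    have x: "x \<in> T" "\<And>y. y \<in> T \<Longrightarrow> x \<le> y"
      using False finT by (auto simp: x_def)
    have "T - {x} \<subseteq> S \<inter> {p + k..}"
    proof
      fix y assume y: "y \<in> T - {x}"
      then have "x + k \<le> y" using T(2) x unfolding separated_def by force
      then show "y \<in> S \<inter> {p + k..}" using y x T(1) by fastforce
    qed
    moreover have "separated k (T - {x})" using T(2) by (auto simp: separated_def)
    ultimately have "card (T - {x}) \<le> separation k (S \<inter> {p + k..})"
      using assms(1) by (intro separation_ge) auto
    then show ?thesis using x(1) finT T(3) by simp
  qed (use T(3) in simp)
next
  obtain T where T: "T \<subseteq> S \<inter> {p + k..}" "separated k T" "card T = separation k (S \<inter> {p + k..})"
    using separation_obtain[of "S \<inter> {p + k..}" k] assms by auto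
  have finT: "finite T" using T(1) assms(1) by (meson finite_Int finite_subset)
  have "card (insert p T) \<le> separation k (S \<inter> {p..})"
  proof (rule separation_ge)
    show "insert p T \<subseteq> S \<inter> {p..}" using T(1) assms(2) by auto
    show "separated k (insert p T)"
      using T(1,2) by (auto simp: separated_def)
  qed (use assms in auto)
  moreover have "p \<notin> T" using T(1) assms(3) by auto
  ultimately show "Suc (separation k (S \<inter> {p + k..})) \<le> separation k (S \<inter> {p..})"
    using T(3) finT by simp
qed

lemma k_measure_eq_separation:
  assumes l: "l \<in> distinct_partitions" and k: "k \<ge> 1"
  shows "k_measure k l = separation k (parts l)"
proof -
  let ?ok = "\<lambda>is. sorted_wrt (<) is \<and> set is \<subseteq> part_indices l \<and>
     (\<forall>j. Suc j < length is \<longrightarrow> l (is ! j) \<ge> l (is ! Suc j) + k)"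
  have anti: "antimono l" and fin: "finite (part_indices l)" and inj: "inj_on l (part_indices l)"
    using l by (auto simp: distinct_partitions_def is_partition_def)
  have "{length is | is. ?ok is} = card ` {T. T \<subseteq> parts l \<and> separated k T}"
  proof (intro set_eqI iffI)
    fix n assume "n \<in> {length is | is. ?ok is}"
    then obtain "is" where "is": "?ok is" "n = length is" by blast
    have sep: "l (is ! i) \<ge> l (is ! j) + k" if "i < j" "j < length is" for i j
    proof -
      have "is ! Suc i \<le> is ! j"
        using sorted_wrt_nth_less[of "(<)" "is" "Suc i" j] "is"(1) that by (cases "Suc i = j") auto
      then have "l (is ! j) \<le> l (is ! Suc i)" using anti by (rule antimonoD[rotated])
      then show ?thesis using "is"(1) that by (metis Suc_lessI add_le_mono1 le_trans less_trans_Suc)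
    qed
    have "separated k (l ` set is)"
      unfolding separated_def
    proof (intro ballI impI)
      fix x y assume "x \<in> l ` set is" "y \<in> l ` set is" "x < y"
      then obtain i j where "i < length is" "j < length is" "x = l (is ! i)" "y = l (is ! j)"
        by (metis imageE in_set_conv_nth)
      then show "x + k \<le> y"
        using sep[of i j] sep[of j i] \<open>x < y\<close> by (cases i j rule: linorder_cases) auto
    qed
    moreover have "card (l ` set is) = n"
      using "is" by (metis card_image distinct_card inj inj_on_subset strict_sorted_iff)
    ultimately show "n \<in> card ` {T. T \<subseteq> parts l \<and> separated k T}"
      using "is" by (auto simp: parts_def image_iff intro!: exI[of _ "l ` set is"])
  next
    fix n assume "n \<in> card ` {T. T \<subseteq> parts l \<and> separated k T}"
    then obtain T where T: "T \<subseteq> parts l" "separated k T" "n = card T" by blast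
    define I where "I = {i \<in> part_indices l. l i \<in> T}"
    have finI: "finite I" using fin by (simp add: I_def)
    have lI: "l ` I = T" using T(1) by (auto simp: I_def parts_def)
    have "inj_on l I" using inj by (rule inj_on_subset) (auto simp: I_def)
    then have card: "card I = n" using lI T(3) by (metis card_image)
    define "is" where "is = sorted_list_of_set I"
    have set: "set is = I" and len: "length is = n" and sorted: "sorted_wrt (<) is"
      using finI card by (auto simp: is_def)
    have "l (is ! j) \<ge> l (is ! Suc j) + k" if j: "Suc j < length is" for j
    proof -
      have mem: "is ! j \<in> I" "is ! Suc j \<in> I" using j set by (metis Suc_lessD nth_mem)+
      have lt: "is ! j < is ! Suc j" using sorted j by (simp add: sorted_wrt_iff_nth_less)
      then have "l (is ! Suc j) \<le> l (is ! j)" using anti by (simp add: antimonoD)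
      moreover have "l (is ! Suc j) \<noteq> l (is ! j)"
        using \<open>inj_on l I\<close> mem lt by (metis inj_onD less_irrefl)
      ultimately show ?thesis using T(2) mem lI unfolding separated_def by force
    qed
    then show "n \<in> {length is | is. ?ok is}"
      using set len sorted I_def by (auto intro!: exI[of _ "is"])
  qed
  then show ?thesis unfolding k_measure_def separation_def by simp
qed

definition residues :: "nat \<Rightarrow> nat set \<Rightarrow> nat multiset" where
  "residues k S = image_mset (\<lambda>s. s mod k) (mset_set S)"

lemma residues_empty [simp]: "residues k {} = {#}"
  by (simp add: residues_def)

lemma residues_insert:
  "finite S \<Longrightarrow> p \<notin> S \<Longrightarrow> residues k (insert p S) = add_mset (p mod k) (residues k S)"
  by (simp add: residues_def)

text \<open>
  The amount \<open>\<Sum>(k - i) a\<^sub>i\<close> that rounds all parts up to multiples of \<open>k\<close>.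
\<close>
definition residue_defect :: "nat \<Rightarrow> nat multiset \<Rightarrow> nat" where
  "residue_defect k a = (\<Sum>r\<in>#a. if r = 0 then 0 else k - r)"

section \<open>Distinct partitions and sets inside a window\<close>

text \<open>
  For a fixed \<open>M\<close> the multisets \<open>E\<close> are counted by \<open>1 / (q)\<^sub>M\<close> and the sets \<open>S\<close> by the product of
  \<open>1 + t\<^sub>j\<close> over \<open>p \<le> j < b + k M\<close>. The condition on the weight is an arbitrary predicate \<open>C\<close>, so that
  removing a part from \<open>S\<close> just replaces \<open>C\<close> by a shifted predicate.
\<close>
definition windowed :: "nat \<Rightarrow> nat \<Rightarrow> nat \<Rightarrow> (nat \<Rightarrow> nat \<Rightarrow> nat multiset \<Rightarrow> bool) \<Rightarrow>
    (nat \<times> nat multiset \<times> nat set) set" where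
  "windowed k p b C = {(M, E, S). set_mset E \<subseteq> {1..M} \<and> S \<subseteq> {p..<b + k * M} \<and>
     C M (k * \<Sum>\<^sub># E + \<Sum>S) (residues k S)}"

text \<open>
  The surplus pairs \<open>(M, E)\<close> times the sets \<open>S\<close> of parts at least \<open>p\<close>. The measure ignores the parts
  below \<open>b\<close>: they are the ones that lie too close to the part chosen last.
\<close>
definition measured :: "nat \<Rightarrow> nat \<Rightarrow> nat \<Rightarrow> (nat \<Rightarrow> nat \<Rightarrow> nat multiset \<Rightarrow> bool) \<Rightarrow>
    (nat \<times> nat multiset \<times> nat set) set" where
  "measured k p b C = {(M, E, S). set_mset E \<subseteq> {1..M} \<and> finite S \<and> S \<subseteq> {p..} \<and>
     C (separation k (S \<inter> {b..}) + M) (k * \<Sum>\<^sub># E + \<Sum>S) (residues k S)}"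

lemma atLeast_Suc_if_notin: "p \<notin> S \<Longrightarrow> S \<subseteq> {p..<c} \<longleftrightarrow> S \<subseteq> {Suc p..<c}" for p c :: nat
  by (force simp: Suc_le_eq le_less)

lemma windowed_free_notin:
  assumes "p < b"
  shows "{x \<in> windowed k p b C. p \<notin> snd (snd x)} = windowed k (Suc p) b C"
  using atLeast_Suc_if_notin[of p] by (fastforce simp: windowed_def)

lemma windowed_free_in:
  assumes "p < b"
  shows "{x \<in> windowed k p b C. p \<in> snd (snd x)} \<approx>
    windowed k (Suc p) b (\<lambda>m n a. C m (n + p) (add_mset (p mod k) a))"
proof (rule eqpoll_byWitness[where f = "\<lambda>(M, E, S). (M, E, S - {p})" and g = "\<lambda>(M, E, S). (M, E, insert p S)"])
  fix x assume "x \<in> {x \<in> windowed k p b C. p \<in> snd (snd x)}"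
  then obtain M E S where x: "x = (M, E, S)" "p \<in> S" "S \<subseteq> {p..<b + k * M}" "set_mset E \<subseteq> {1..M}"
    "C M (k * \<Sum>\<^sub># E + \<Sum>S) (residues k S)" by (auto simp: windowed_def)
  have fin: "finite S" using x(3) finite_subset by blast
  have S: "S = insert p (S - {p})" using x(2) by blast
  have "\<Sum>S = \<Sum>(S - {p}) + p" using fin x(2) by (simp add: sum.remove)
  moreover have "residues k S = add_mset (p mod k) (residues k (S - {p}))"
    using residues_insert[of "S - {p}" p k] fin S by auto
  moreover have "S - {p} \<subseteq> {Suc p..<b + k * M}" using x(3) by (force simp: Suc_le_eq le_less)
  ultimately show "(case x of (M, E, S) \<Rightarrow> (M, E, S - {p}))
      \<in> windowed k (Suc p) b (\<lambda>m n a. C m (n + p) (add_mset (p mod k) a))"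
    using x by (simp add: windowed_def add.assoc)
  show "(case case x of (M, E, S) \<Rightarrow> (M, E, S - {p}) of (M, E, S) \<Rightarrow> (M, E, insert p S)) = x"
    using x by auto
next
  fix x assume "x \<in> windowed k (Suc p) b (\<lambda>m n a. C m (n + p) (add_mset (p mod k) a))"
  then obtain M E S where x: "x = (M, E, S)" "S \<subseteq> {Suc p..<b + k * M}" "set_mset E \<subseteq> {1..M}"
    "C M (k * \<Sum>\<^sub># E + \<Sum>S + p) (add_mset (p mod k) (residues k S))" by (auto simp: windowed_def)
  have fin: "finite S" using x(2) finite_subset by blast
  have p: "p \<notin> S" using x(2) by auto
  have "insert p S \<subseteq> {p..<b + k * M}" using x(2) assms by force
  then show "(case x of (M, E, S) \<Rightarrow> (M, E, insert p S)) \<in> {x \<in> windowed k p b C. p \<in> snd (snd x)}"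
    using x p fin by (simp add: windowed_def residues_insert add.assoc add.commute[of p])
  show "(case case x of (M, E, S) \<Rightarrow> (M, E, insert p S) of (M, E, S) \<Rightarrow> (M, E, S - {p})) = x"
    using x p by auto
qed

text \<open>
  The case in which \<open>p\<close> is the next chosen part. Removing it uses up one unit of \<open>M\<close>. The upper end of
  the window stays where it is, as \<open>p + k M = (p + k) + k (M - 1)\<close>, and \<open>E\<close> is still bounded by
  \<open>M - 1\<close> because it does not contain \<open>M\<close>.
\<close>
lemma windowed_close:
  assumes "k \<ge> 1"
  shows "{x \<in> windowed k p p C. p \<in> snd (snd x) \<and> fst x \<notin># fst (snd x)} \<approx>
    windowed k (Suc p) (p + k) (\<lambda>m n a. C (Suc m) (n + p) (add_mset (p mod k) a))"
proof (rule eqpoll_byWitness[where f = "\<lambda>(M, E, S). (M - 1, E, S - {p})" and g = "\<lambda>(M, E, S). (Suc M, E, insert p S)"])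
  fix x assume "x \<in> {x \<in> windowed k p p C. p \<in> snd (snd x) \<and> fst x \<notin># fst (snd x)}"
  then obtain M E S where x: "x = (M, E, S)" "p \<in> S" "S \<subseteq> {p..<p + k * M}" "set_mset E \<subseteq> {1..M}"
    "C M (k * \<Sum>\<^sub># E + \<Sum>S) (residues k S)" "M \<notin># E" by (auto simp: windowed_def)
  \<comment> \<open>For \<open>M = 0\<close> the window is empty and cannot contain \<open>p\<close>.\<close>
  obtain M' where M: "M = Suc M'" using x(2,3) by (cases M) auto
  have E: "set_mset E \<subseteq> {1..M'}" using x(4,6) M by (force simp: le_Suc_eq)
  have fin: "finite S" using x(3) finite_subset by blast
  have S: "S = insert p (S - {p})" using x(2) by blast
  have "\<Sum>S = \<Sum>(S - {p}) + p" using fin x(2) by (simp add: sum.remove)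
  moreover have "residues k S = add_mset (p mod k) (residues k (S - {p}))"
    using residues_insert[of "S - {p}" p k] fin S by auto
  moreover have "S - {p} \<subseteq> {Suc p..<p + k + k * M'}"
    using x(3) M by (force simp: Suc_le_eq le_less)
  ultimately show "(case x of (M, E, S) \<Rightarrow> (M - 1, E, S - {p}))
      \<in> windowed k (Suc p) (p + k) (\<lambda>m n a. C (Suc m) (n + p) (add_mset (p mod k) a))"
    using x E M by (simp add: windowed_def add.assoc)
  show "(case case x of (M, E, S) \<Rightarrow> (M - 1, E, S - {p}) of (M, E, S) \<Rightarrow> (Suc M, E, insert p S)) = x"
    using x M by auto
next
  fix x assume "x \<in> windowed k (Suc p) (p + k) (\<lambda>m n a. C (Suc m) (n + p) (add_mset (p mod k) a))"
  then obtain M E S where x: "x = (M, E, S)" "S \<subseteq> {Suc p..<p + k + k * M}" "set_mset E \<subseteq> {1..M}"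
    "C (Suc M) (k * \<Sum>\<^sub># E + \<Sum>S + p) (add_mset (p mod k) (residues k S))" by (auto simp: windowed_def)
  have fin: "finite S" using x(2) finite_subset by blast
  have p: "p \<notin> S" using x(2) by auto
  have "insert p S \<subseteq> {p..<p + k * Suc M}" using x(2) assms by force
  moreover have "set_mset E \<subseteq> {1..Suc M}" "Suc M \<notin># E" using x(3) by force+
  ultimately show "(case x of (M, E, S) \<Rightarrow> (Suc M, E, insert p S))
      \<in> {x \<in> windowed k p p C. p \<in> snd (snd x) \<and> fst x \<notin># fst (snd x)}"
    using x p fin by (simp add: windowed_def residues_insert add.assoc add.commute[of p])
  show "(case case x of (M, E, S) \<Rightarrow> (Suc M, E, insert p S) of (M, E, S) \<Rightarrow> (M - 1, E, S - {p})) = x"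
    using x p by auto
qed

text \<open>
  The whole window moves up by 1. If the part \<open>p\<close> would fall out of it and \<open>E\<close> contains \<open>M\<close>, then that
  element \<open>M\<close>, which is worth \<open>k M\<close>, is spent to move \<open>p\<close> to the new position \<open>p + k M\<close> at the other
  end; this does not change its residue. In the reverse direction the presence of \<open>p + k M\<close> tells
  that such a move took place.
\<close>
lemma windowed_shift:
  assumes "k \<ge> 1"
  shows "{x \<in> windowed k p p C. p \<notin> snd (snd x) \<or> fst x \<in># fst (snd x)} \<approx> windowed k (Suc p) (Suc p) C"
proof (rule eqpoll_byWitness[where
    f = "\<lambda>(M, E, S). if p \<in> S then (M, E - {#M#}, insert (p + k * M) (S - {p})) else (M, E, S)" and
    g = "\<lambda>(M, E, S). if p + k * M \<in> S then (M, add_mset M E, insert p (S - {p + k * M})) else (M, E, S)"])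
  let ?f = "\<lambda>(M, E, S). if p \<in> S then (M, E - {#M#}, insert (p + k * M) (S - {p})) else (M, E, S)"
  let ?g = "\<lambda>(M, E, S). if p + k * M \<in> S then (M, add_mset M E, insert p (S - {p + k * M})) else (M, E, S)"
  fix x assume "x \<in> {x \<in> windowed k p p C. p \<notin> snd (snd x) \<or> fst x \<in># fst (snd x)}"
  then obtain M E S where x: "x = (M, E, S)" "p \<in> S \<Longrightarrow> M \<in># E" "S \<subseteq> {p..<p + k * M}"
    "set_mset E \<subseteq> {1..M}" "C M (k * \<Sum>\<^sub># E + \<Sum>S) (residues k S)" by (auto simp: windowed_def)
  have fin: "finite S" using x(3) finite_subset by blast
  have top: "p + k * M \<notin> S" using x(3) by auto
  have "?f x \<in> windowed k (Suc p) (Suc p) C \<and> ?g (?f x) = x"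
  proof (cases "p \<in> S")
    case True
    then have ME: "M \<in># E" and M: "M \<ge> 1" using x(2,4) by auto
    obtain E' where E': "E = add_mset M E'" using ME by (metis mset_add)
    let ?S = "S - {p}"
    have S: "S = insert p ?S" using True by blast
    have kM: "k * M \<ge> 1" using M assms by simp
    have "\<Sum>S = p + \<Sum>?S" using fin True by (simp add: sum.remove)
    moreover have "residues k S = add_mset (p mod k) (residues k ?S)"
      using residues_insert[of ?S p k] fin S by auto
    moreover have "insert (p + k * M) ?S \<subseteq> {Suc p..<Suc p + k * M}"
    proof -
      have "?S \<subseteq> {Suc p..<p + k * M}" using atLeast_Suc_if_notin[of p ?S "p + k * M"] x(3) by blast
      then show ?thesis using kM by auto
    qed
    moreover have "set_mset (E - {#M#}) \<subseteq> {1..M}" using x(4) by (meson in_diffD subset_iff)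
    ultimately have "?f x \<in> windowed k (Suc p) (Suc p) C"
      using x True fin top E' by (simp add: windowed_def residues_insert algebra_simps)
    moreover have "?g (?f x) = x"
      using True x top ME S by auto
    ultimately show ?thesis by blast
  next
    case False
    then have "S \<subseteq> {Suc p..<Suc p + k * M}" using x(3) by (force simp: Suc_le_eq le_less)
    then show ?thesis using x False top by (simp add: windowed_def)
  qed
  then show "?f x \<in> windowed k (Suc p) (Suc p) C" "?g (?f x) = x" by auto
next
  let ?f = "\<lambda>(M, E, S). if p \<in> S then (M, E - {#M#}, insert (p + k * M) (S - {p})) else (M, E, S)"
  let ?g = "\<lambda>(M, E, S). if p + k * M \<in> S then (M, add_mset M E, insert p (S - {p + k * M})) else (M, E, S)"
  fix x assume "x \<in> windowed k (Suc p) (Suc p) C"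
  then obtain M E S where x: "x = (M, E, S)" "S \<subseteq> {Suc p..<Suc p + k * M}"
    "set_mset E \<subseteq> {1..M}" "C M (k * \<Sum>\<^sub># E + \<Sum>S) (residues k S)" by (auto simp: windowed_def)
  have fin: "finite S" using x(2) finite_subset by blast
  have p: "p \<notin> S" using x(2) by auto
  have "?g x \<in> {x \<in> windowed k p p C. p \<notin> snd (snd x) \<or> fst x \<in># fst (snd x)} \<and> ?f (?g x) = x"
  proof (cases "p + k * M \<in> S")
    case True
    let ?q = "p + k * M"
    let ?S = "S - {?q}"
    have S: "S = insert ?q ?S" using True by blast
    \<comment> \<open>The lower end of the window is \<open>p + 1\<close>, which excludes \<open>M = 0\<close>.\<close>
    have M: "M \<ge> 1" using True p by (cases M) auto
    have kM: "k * M \<ge> 1" using M assms by simp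
    have "\<Sum>S = ?q + \<Sum>?S" using fin True by (simp add: sum.remove)
    moreover have "residues k S = add_mset (?q mod k) (residues k ?S)"
      using residues_insert[of ?S ?q k] fin S by auto
    moreover have "insert p ?S \<subseteq> {p..<p + k * M}"
      using x(2) kM by (force simp: less_Suc_eq)
    ultimately have "?g x \<in> {x \<in> windowed k p p C. p \<notin> snd (snd x) \<or> fst x \<in># fst (snd x)}"
      using x True fin p M by (simp add: windowed_def residues_insert algebra_simps)
    moreover have "?f (?g x) = x"
      using True x p S by auto
    ultimately show ?thesis by blast
  next
    case False
    then have "S \<subseteq> {p..<p + k * M}" using x(2) by (force simp: less_Suc_eq)
    then show ?thesis using x False p by (simp add: windowed_def)
  qed
  then show "?g x \<in> {x \<in> windowed k p p C. p \<notin> snd (snd x) \<or> fst x \<in># fst (snd x)}" "?f (?g x) = x"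
    by blast+
qed

lemma measured_in:
  "{x \<in> measured k p b C. p \<in> snd (snd x)} \<approx> {(M, E, S). set_mset E \<subseteq> {1..M} \<and> finite S \<and> S \<subseteq> {Suc p..} \<and>
     C (separation k (insert p S \<inter> {b..}) + M) (k * \<Sum>\<^sub># E + \<Sum>S + p) (add_mset (p mod k) (residues k S))}"
    (is "_ \<approx> ?V")
proof (rule eqpoll_byWitness[where f = "\<lambda>(M, E, S). (M, E, S - {p})" and g = "\<lambda>(M, E, S). (M, E, insert p S)"])
  fix x assume "x \<in> {x \<in> measured k p b C. p \<in> snd (snd x)}"
  then obtain M E S where x: "x = (M, E, S)" "p \<in> S" "finite S" "S \<subseteq> {p..}" "set_mset E \<subseteq> {1..M}"
    "C (separation k (S \<inter> {b..}) + M) (k * \<Sum>\<^sub># E + \<Sum>S) (residues k S)" by (auto simp: measured_def)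
  have S: "insert p (S - {p}) = S" using x(2) by blast
  have "\<Sum>S = \<Sum>(S - {p}) + p" using x(2,3) by (simp add: sum.remove)
  moreover have "residues k S = add_mset (p mod k) (residues k (S - {p}))"
    using residues_insert[of "S - {p}" p k] x(3) S by auto
  moreover have "S - {p} \<subseteq> {Suc p..}" using x(4) by (force simp: Suc_le_eq le_less)
  ultimately show "(case x of (M, E, S) \<Rightarrow> (M, E, S - {p})) \<in> ?V"
    using x S by (simp add: add.assoc)
  show "(case case x of (M, E, S) \<Rightarrow> (M, E, S - {p}) of (M, E, S) \<Rightarrow> (M, E, insert p S)) = x"
    using x by auto
next
  fix x assume "x \<in> ?V"
  then obtain M E S where x: "x = (M, E, S)" "finite S" "S \<subseteq> {Suc p..}" "set_mset E \<subseteq> {1..M}"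
    "C (separation k (insert p S \<inter> {b..}) + M) (k * \<Sum>\<^sub># E + \<Sum>S + p) (add_mset (p mod k) (residues k S))"
    by auto
  have p: "p \<notin> S" using x(3) by auto
  have "insert p S \<subseteq> {p..}" using x(3) by force
  then show "(case x of (M, E, S) \<Rightarrow> (M, E, insert p S)) \<in> {x \<in> measured k p b C. p \<in> snd (snd x)}"
    using x p by (simp add: measured_def residues_insert add.assoc add.commute[of p] del: Int_insert_left)
  show "(case case x of (M, E, S) \<Rightarrow> (M, E, insert p S) of (M, E, S) \<Rightarrow> (M, E, S - {p})) = x"
    using x p by auto
qed

lemma measured_free_in:
  assumes "p < b"
  shows "{x \<in> measured k p b C. p \<in> snd (snd x)} \<approx>
    measured k (Suc p) b (\<lambda>m n a. C m (n + p) (add_mset (p mod k) a))"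
proof -
  have "insert p S \<inter> {b..} = S \<inter> {b..}" for S :: "nat set" using assms by auto
  then show ?thesis using measured_in[of k p b C] by (simp add: measured_def)
qed

lemma measured_close:
  assumes "k \<ge> 1"
  shows "{x \<in> measured k p p C. p \<in> snd (snd x)} \<approx>
    measured k (Suc p) (p + k) (\<lambda>m n a. C (Suc m) (n + p) (add_mset (p mod k) a))"
proof -
  have "separation k (insert p S \<inter> {p..}) = Suc (separation k (S \<inter> {p + k..}))" if "finite S" for S
  proof -
    have "insert p S \<inter> {p + k..} = S \<inter> {p + k..}" using assms by auto
    then show ?thesis using separation_rec[of "insert p S" p k] assms that by simp
  qed
  then have "{(M, E, S). set_mset E \<subseteq> {1..M} \<and> finite S \<and> S \<subseteq> {Suc p..} \<and>
     C (separation k (insert p S \<inter> {p..}) + M) (k * \<Sum>\<^sub># E + \<Sum>S + p) (add_mset (p mod k) (residues k S))}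
    = measured k (Suc p) (p + k) (\<lambda>m n a. C (Suc m) (n + p) (add_mset (p mod k) a))"
    unfolding measured_def by (intro Collect_cong) (auto split: prod.split)
  then show ?thesis using measured_in[of k p p C] by simp
qed

lemma atLeast_Suc_iff_notin: "S \<subseteq> {Suc p..} \<longleftrightarrow> S \<subseteq> {p..} \<and> p \<notin> S"
  by (force simp: Suc_le_eq le_less)

lemma measured_notin:
  assumes "p < b"
  shows "{x \<in> measured k p b C. p \<notin> snd (snd x)} = measured k (Suc p) b C"
proof -
  show ?thesis
  proof (rule set_eqI)
    fix x :: "nat \<times> nat multiset \<times> nat set"
    obtain M E S where x: "x = (M, E, S)" by (rule prod_cases3)
    show "x \<in> {x \<in> measured k p b C. p \<notin> snd (snd x)} \<longleftrightarrow> x \<in> measured k (Suc p) b C"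
      using atLeast_Suc_iff_notin[of S p] by (simp add: x measured_def) blast
  qed
qed

lemma measured_skip: "{x \<in> measured k p p C. p \<notin> snd (snd x)} = measured k (Suc p) (Suc p) C"
proof (rule set_eqI)
  fix x :: "nat \<times> nat multiset \<times> nat set"
  obtain M E S where x: "x = (M, E, S)" by (rule prod_cases3)
  show "x \<in> {x \<in> measured k p p C. p \<notin> snd (snd x)} \<longleftrightarrow> x \<in> measured k (Suc p) (Suc p) C"
  proof (cases "p \<in> S")
    case False
    have "S \<inter> {p..} = S \<inter> {Suc p..}"
      using False by (auto simp: Suc_le_eq nat_less_le)
    then show ?thesis using atLeast_Suc_iff_notin[of S p] False by (simp add: x measured_def)
  qed (auto simp: x measured_def)
qed

text \<open>
  Both sides split in the same way according to what happens at position \<open>p\<close>: for \<open>p < b\<close> the part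
  \<open>p\<close> is absent or present without any effect on the measure, and for \<open>p = b\<close> it is absent or it is the
  next chosen part. The bound \<open>N\<close> on the total weight makes the recursion end, since a nonempty set of
  numbers above \<open>N\<close> has too large a sum.
\<close>
lemma windowed_eqpoll_measured:
  assumes k: "k \<ge> 1" and "p \<le> b" and "\<And>m n a. C m n a \<Longrightarrow> n \<le> N"
  shows "windowed k p b C \<approx> measured k p b C"
  using assms(2,3)
proof (induction "N + 1 - p" arbitrary: p b C rule: less_induct)
  case less
  note C = less.prems(2)
  have C': "n \<le> N" if "C m (n + p) a" for m n a using C[OF that] by simp
  show ?case
  proof (cases "p \<le> N")
    case False
    have empty: "S = {}" if "finite S" "S \<subseteq> {p..}" "C m (n + \<Sum>S) a" for S m n a
    proof (rule ccontr)
      assume "S \<noteq> {}"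
      then obtain s where "s \<in> S" by blast
      then have "s \<le> \<Sum>S" using that(1) member_le_sum[of s S "\<lambda>x. x"] by simp
      moreover have "p \<le> s" using \<open>s \<in> S\<close> that(2) by auto
      ultimately show False using C[OF that(3)] False by simp
    qed
    let ?T = "{(M, E, S). set_mset E \<subseteq> {1..M} \<and> S = {} \<and> C M (k * \<Sum>\<^sub># E) {#}}"
    have "x \<in> windowed k p b C \<longleftrightarrow> x \<in> ?T" for x
    proof -
      obtain M E S where x: "x = (M, E, S)" by (rule prod_cases3)
      show ?thesis
      proof (cases "S = {}")
        case False
        then have "\<not> (S \<subseteq> {p..<b + k * M} \<and> C M (k * \<Sum>\<^sub># E + \<Sum>S) (residues k S))"
          using empty[of S M "k * \<Sum>\<^sub># E" "residues k S"] finite_subset[of S "{p..<b + k * M}"] by force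
        with False show ?thesis by (simp add: x windowed_def)
      qed (simp add: x windowed_def)
    qed
    moreover have "x \<in> measured k p b C \<longleftrightarrow> x \<in> ?T" for x
    proof -
      obtain M E S where x: "x = (M, E, S)" by (rule prod_cases3)
      show ?thesis
      proof (cases "S = {}")
        case False
        then have "\<not> (finite S \<and> S \<subseteq> {p..} \<and>
            C (separation k (S \<inter> {b..}) + M) (k * \<Sum>\<^sub># E + \<Sum>S) (residues k S))"
          using empty[of S _ "k * \<Sum>\<^sub># E" "residues k S"] by blast
        with False show ?thesis by (simp add: x measured_def)
      qed (simp add: x measured_def)
    qed
    ultimately have "windowed k p b C = measured k p b C" by (intro set_eqI) (simp only:)
    then show ?thesis by simp
  next
    case True
    show ?thesis
    proof (cases "p = b")
      case False
      then have pb: "p < b" using less.prems by simp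
      let ?C = "\<lambda>m n a. C m (n + p) (add_mset (p mod k) a)"
      have 1: "windowed k (Suc p) b C \<approx> measured k (Suc p) b C"
        using True pb by (intro less.hyps C) auto
      have 2: "windowed k (Suc p) b ?C \<approx> measured k (Suc p) b ?C"
        using True pb by (intro less.hyps) (simp, simp, erule C')
      show ?thesis
      proof (rule eqpoll_split[where P = "\<lambda>x. p \<in> snd (snd x)" and Q = "\<lambda>x. p \<in> snd (snd x)"])
        show "{x \<in> windowed k p b C. p \<in> snd (snd x)} \<approx> {x \<in> measured k p b C. p \<in> snd (snd x)}"
          using eqpoll_trans[OF eqpoll_trans[OF windowed_free_in[OF pb] 2] eqpoll_sym[OF measured_free_in[OF pb]]] .
        show "{x \<in> windowed k p b C. p \<notin> snd (snd x)} \<approx> {x \<in> measured k p b C. p \<notin> snd (snd x)}"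
          using 1 by (simp only: windowed_free_notin[OF pb] measured_notin[OF pb])
      qed
    next
      case b: True
      let ?C = "\<lambda>m n a. C (Suc m) (n + p) (add_mset (p mod k) a)"
      have 1: "windowed k (Suc p) (Suc p) C \<approx> measured k (Suc p) (Suc p) C"
        using True by (intro less.hyps C) auto
      have 2: "windowed k (Suc p) (p + k) ?C \<approx> measured k (Suc p) (p + k) ?C"
        using True k by (intro less.hyps) (simp, simp, erule C')
      have "windowed k p p C \<approx> measured k p p C"
      proof (rule eqpoll_split[where P = "\<lambda>x. p \<in> snd (snd x) \<and> fst x \<notin># fst (snd x)" and Q = "\<lambda>x. p \<in> snd (snd x)"])
        show "{x \<in> windowed k p p C. p \<in> snd (snd x) \<and> fst x \<notin># fst (snd x)} \<approx> {x \<in> measured k p p C. p \<in> snd (snd x)}"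
          using eqpoll_trans[OF eqpoll_trans[OF windowed_close[OF k] 2] eqpoll_sym[OF measured_close[OF k]]] .
        show "{x \<in> windowed k p p C. \<not> (p \<in> snd (snd x) \<and> fst x \<notin># fst (snd x))} \<approx> {x \<in> measured k p p C. p \<notin> snd (snd x)}"
          using eqpoll_trans[OF windowed_shift[OF k] 1] by (simp add: measured_skip)
      qed
      then show ?thesis using b by simp
    qed
  qed
qed

section \<open>Words as eventually constant sequences\<close>

text \<open>
  Words of different lengths become functions on one domain if the final letter \<open>m\<close> is repeated for
  ever. No ascent is created, since a step from \<open>m\<close> to \<open>m\<close> is not an ascent. As a word ends with a
  single \<open>m\<close>, its length can be recovered, see \<open>padded_eq_iff\<close>.
\<close>
definition padded :: "nat \<Rightarrow> nat list \<Rightarrow> nat \<Rightarrow> nat" where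
  "padded m w i = (if i < length w then w ! i else m)"

definition padded_words :: "nat \<Rightarrow> (nat \<Rightarrow> nat) set" where
  "padded_words m = {g. range g \<subseteq> {1..m} \<and> finite {i. g i \<noteq> m}}"

definition ascents :: "nat \<Rightarrow> (nat \<Rightarrow> nat) \<Rightarrow> nat set" where
  "ascents m g = {i. 1 \<le> i \<and> (g (i - 1) < g i \<or> (g (i - 1) = g i \<and> g i < m))}"

lemma wordsD:
  assumes "w \<in> words m"
  shows "length w \<ge> 1" "set w \<subseteq> {1..m}" "w ! (length w - 1) = m"
    "length w \<ge> 2 \<Longrightarrow> w ! (length w - 2) \<noteq> m" "w \<noteq> []"
  using assms by (auto simp: words_def)

lemma padded_eq_iff:
  assumes "w \<in> words m"
  shows "(\<forall>i\<ge>n. padded m w i = m) \<longleftrightarrow> length w \<le> Suc n"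
proof
  assume *: "\<forall>i\<ge>n. padded m w i = m"
  show "length w \<le> Suc n"
  proof (rule ccontr)
    assume "\<not> length w \<le> Suc n"
    then have "length w - 2 \<ge> n" "length w \<ge> 2" by auto
    then show False using * wordsD[OF assms] by (auto simp: padded_def)
  qed
next
  assume *: "length w \<le> Suc n"
  show "\<forall>i\<ge>n. padded m w i = m"
  proof (intro allI impI)
    fix i assume "i \<ge> n"
    with * have "i < length w \<Longrightarrow> i = length w - 1" by auto
    then show "padded m w i = m" using wordsD(3)[OF assms] by (auto simp: padded_def)
  qed
qed

lemma padded_non_max:
  assumes "w \<in> words m"
  shows "{i. padded m w i \<noteq> m} = {i. i < length w \<and> w ! i \<noteq> m}"
  by (auto simp: padded_def)

lemma bij_padded:
  assumes "m \<ge> 1"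
  shows "bij_betw (padded m) (words m) (padded_words m)"
  unfolding bij_betw_def
proof
  show "inj_on (padded m) (words m)"
  proof (rule inj_onI)
    fix w w' assume w: "w \<in> words m" "w' \<in> words m" "padded m w = padded m w'"
    have "length w \<le> Suc n \<longleftrightarrow> length w' \<le> Suc n" for n
      using padded_eq_iff[OF w(1)] padded_eq_iff[OF w(2)] w(3) by simp
    from this[of "length w - 1"] this[of "length w' - 1"] wordsD(1)[OF w(1)] wordsD(1)[OF w(2)]
    have "length w = length w'" by (simp; linarith)
    then show "w = w'"
      by (rule nth_equalityI) (metis w(3) padded_def \<open>length w = length w'\<close>)
  qed
  have "padded m w \<in> padded_words m" if w: "w \<in> words m" for w
  proof -
    have "w ! i \<in> {1..m}" if "i < length w" for i
      using wordsD(2)[OF w] nth_mem[OF that] by (rule subsetD)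
    then show ?thesis using padded_non_max[OF w] assms by (auto simp: padded_words_def padded_def)
  qed
  moreover have "\<exists>w \<in> words m. padded m w = g" if g: "g \<in> padded_words m" for g
  proof -
    let ?I = "{i. g i \<noteq> m}"
    have fin: "finite ?I" and range: "\<And>i. g i \<in> {1..m}" using g unfolding padded_words_def by blast+
    \<comment> \<open>The letters from position \<open>n\<close> on equal \<open>m\<close>, and the word keeps one of them.\<close>
    define n where "n = (if ?I = {} then 0 else Suc (Max ?I))"
    have above: "g i = m" if "i \<ge> n" for i
      using Max_ge[OF fin, of i] that by (auto simp: n_def split: if_splits)
    have last: "g (n - 1) \<noteq> m" if "n \<ge> 1"
      using Max_in[OF fin] that by (auto simp: n_def split: if_splits)
    let ?w = "map g [0..<n] @ [m]"
    have "set ?w \<subseteq> {1..m}" using range assms by auto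
    moreover have "?w ! (length ?w - 2) \<noteq> m" if "length ?w \<ge> 2"
      using last that by (auto simp: nth_append)
    ultimately have "?w \<in> words m" by (simp add: words_def nth_append)
    moreover have "padded m ?w = g"
    proof
      fix i
      show "padded m ?w i = g i"
        using above[of i] by (cases "i < n") (simp_all add: padded_def nth_append)
    qed
    ultimately show ?thesis by blast
  qed
  ultimately show "padded m ` words m = padded_words m" by blast
qed

lemma ascents_padded:
  assumes "w \<in> words m"
  shows "ascents m (padded m w) = beta_ascents m w"
proof (rule set_eqI)
  fix i
  show "i \<in> ascents m (padded m w) \<longleftrightarrow> i \<in> beta_ascents m w"
  proof (cases "i < length w")
    case True
    then show ?thesis by (auto simp: ascents_def beta_ascents_def padded_def)
  next
    case False
    have *: "\<forall>i\<ge>length w - 1. padded m w i = m" using padded_eq_iff[OF assms] by simp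
    have "padded m w i = m" "padded m w (i - 1) = m" using False * by auto
    then show ?thesis using False by (simp add: ascents_def beta_ascents_def)
  qed
qed

text \<open>
  The minimal level of position \<open>i\<close>. Summed over all positions it gives the sum of the ascents, because
  an ascent \<open>j\<close> is counted by the \<open>j\<close> positions before it.
\<close>
definition ascents_after :: "nat \<Rightarrow> (nat \<Rightarrow> nat) \<Rightarrow> nat \<Rightarrow> nat" where
  "ascents_after m g i = card {j \<in> ascents m g. i < j}"

lemma padded_wordsD:
  assumes "g \<in> padded_words m"
  shows "1 \<le> g i" "g i \<le> m" "finite {i. g i \<noteq> m}"
proof -
  have "g i \<in> {1..m}" using assms unfolding padded_words_def by blast
  then show "1 \<le> g i" "g i \<le> m" by auto
qed (use assms in \<open>simp add: padded_words_def\<close>)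

lemma finite_ascents:
  assumes "g \<in> padded_words m"
  shows "finite (ascents m g)"
proof (rule finite_subset)
  show "ascents m g \<subseteq> Suc ` {i. g i \<noteq> m}"
  proof
    fix i assume i: "i \<in> ascents m g"
    have "g i \<le> m" by (rule padded_wordsD[OF assms])
    then have "g (i - 1) \<noteq> m" "i = Suc (i - 1)" using i by (auto simp: ascents_def)
    then show "i \<in> Suc ` {i. g i \<noteq> m}" by blast
  qed
  show "finite (Suc ` {i. g i \<noteq> m})" using assms by (simp add: padded_words_def)
qed

lemma ascents_after_Suc:
  assumes "g \<in> padded_words m"
  shows "ascents_after m g i = ascents_after m g (Suc i) + (if Suc i \<in> ascents m g then 1 else 0)"
proof -
  have "{j \<in> ascents m g. i < j} = {j \<in> ascents m g. Suc i < j} \<union> ({Suc i} \<inter> ascents m g)"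
    by (auto simp: less_Suc_eq_le Suc_le_eq nat_less_le)
  then show ?thesis
    using finite_ascents[OF assms] by (simp add: ascents_after_def card_insert_if)
qed

lemma ascents_after_0: "ascents_after m g 0 = card (ascents m g)"
  unfolding ascents_after_def by (rule arg_cong[where f = card]) (auto simp: ascents_def)

text \<open>
  A letter other than \<open>m\<close> must be followed by an ascent, for the last such letter is followed by \<open>m\<close>.
\<close>
lemma ascents_after_eq_0:
  assumes "g \<in> padded_words m" "ascents_after m g i = 0"
  shows "g i = m"
proof (rule ccontr)
  assume "g i \<noteq> m"
  let ?I = "{i. g i \<noteq> m}"
  have fin: "finite ?I" and le: "\<And>i. g i \<le> m" using padded_wordsD[OF assms(1)] by auto
  define j where "j = Max ?I"
  have "j \<in> ?I" unfolding j_def using fin \<open>g i \<noteq> m\<close> by (intro Max_in) auto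
  moreover have "Suc j \<notin> ?I" using Max_ge[OF fin, of "Suc j"] by (auto simp: j_def)
  moreover have "i \<le> j" unfolding j_def using fin \<open>g i \<noteq> m\<close> by (intro Max_ge) auto
  ultimately have "Suc j \<in> {j \<in> ascents m g. i < j}" using le[of j] by (auto simp: ascents_def)
  then show False using assms(2) finite_ascents[OF assms(1)] by (auto simp: ascents_after_def)
qed

lemma is_partition_ascents_after:
  assumes "g \<in> padded_words m"
  shows "is_partition (ascents_after m g)"
proof -
  obtain n where n: "\<forall>j\<in>ascents m g. j < n"
    using finite_ascents[OF assms] unfolding finite_nat_set_iff_bounded by blast
  have "ascents_after m g i = 0" if "i \<ge> n" for i
  proof -
    have "{j \<in> ascents m g. i < j} = {}" using that n by force
    then show ?thesis by (simp only: ascents_after_def card.empty)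
  qed
  moreover have "ascents_after m g (Suc i) \<le> ascents_after m g i" for i
    unfolding ascents_after_Suc[OF assms, of i] by simp
  ultimately show ?thesis unfolding is_partition_iff by blast
qed

lemma psize_ascents_after:
  assumes "g \<in> padded_words m"
  shows "psize (ascents_after m g) = \<Sum>(ascents m g)"
proof -
  have fin: "finite (ascents m g)" by (rule finite_ascents[OF assms])
  then obtain n where n: "\<forall>j\<in>ascents m g. j < n"
    unfolding finite_nat_set_iff_bounded by blast
  have "ascents_after m g i = 0" if "i \<ge> n" for i
  proof -
    have "{j \<in> ascents m g. i < j} = {}" using that n by force
    then show ?thesis by (simp only: ascents_after_def card.empty)
  qed
  then have "psize (ascents_after m g) = (\<Sum>i<n. ascents_after m g i)" by (rule psize_eq_sum)
  also have "\<dots> = (\<Sum>i<n. \<Sum>j\<in>ascents m g. if i < j then 1 else 0)"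
    unfolding ascents_after_def using fin by (simp add: sum.If_cases Int_def)
  also have "\<dots> = (\<Sum>j\<in>ascents m g. \<Sum>i<n. if i < j then 1 else 0)" by (rule sum.swap)
  also have "\<dots> = (\<Sum>j\<in>ascents m g. j)"
  proof (rule sum.cong[OF refl])
    fix j assume "j \<in> ascents m g"
    then have "{..<n} \<inter> {i. i < j} = {..<j}" using n by force
    then show "(\<Sum>i<n. if i < j then 1 else 0) = j" by (simp add: sum.If_cases)
  qed
  finally show ?thesis .
qed

definition letter_residues :: "nat \<Rightarrow> (nat \<Rightarrow> nat) \<Rightarrow> nat multiset" where
  "letter_residues k g = image_mset (\<lambda>i. g i mod k) (mset_set {i. g i \<noteq> k + 1})"

text \<open>
  Words times partitions \<open>f\<close> with largest part at most \<open>M\<close>.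
\<close>
definition surplus_words :: "nat \<Rightarrow> (nat \<Rightarrow> nat \<Rightarrow> nat multiset \<Rightarrow> bool) \<Rightarrow>
    ((nat \<Rightarrow> nat) \<times> nat \<times> (nat \<Rightarrow> nat)) set" where
  "surplus_words k C = {(g, M, f). g \<in> padded_words (k + 1) \<and> is_partition f \<and> f 0 \<le> M \<and>
     C (M + card (ascents (k + 1) g)) (k * (psize f + \<Sum>(ascents (k + 1) g))) (letter_residues k g)}"

text \<open>
  Words with a level \<open>f i\<close> at each position, such that the levels decrease weakly everywhere and strictly
  at the ascents.
\<close>
definition levelled_words :: "nat \<Rightarrow> (nat \<Rightarrow> nat \<Rightarrow> nat multiset \<Rightarrow> bool) \<Rightarrow>
    (nat \<times> (nat \<Rightarrow> nat) \<times> (nat \<Rightarrow> nat)) set" where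
  "levelled_words k C = {(M, f, g). g \<in> padded_words (k + 1) \<and> is_partition f \<and> f 0 \<le> M \<and>
     (\<forall>i. f (Suc i) + (if Suc i \<in> ascents (k + 1) g then 1 else 0) \<le> f i) \<and>
     C M (k * psize f) (letter_residues k g)}"

text \<open>
  The partition is added to the minimal levels. Conversely, levels that drop at each ascent exceed the
  minimal ones by a partition.
\<close>
lemma surplus_words_eqpoll_levelled_words: "surplus_words k C \<approx> levelled_words k C"
proof (rule eqpoll_byWitness[where
    f = "\<lambda>(g, M, f). (M + card (ascents (k + 1) g), \<lambda>i. f i + ascents_after (k + 1) g i, g)" and
    g = "\<lambda>(M, f, g). (g, M - card (ascents (k + 1) g), \<lambda>i. f i - ascents_after (k + 1) g i)"])
  fix x assume "x \<in> surplus_words k C"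
  then obtain g M f where x: "x = (g, M, f)" "g \<in> padded_words (k + 1)" "is_partition f" "f 0 \<le> M"
    "C (M + card (ascents (k + 1) g)) (k * (psize f + \<Sum>(ascents (k + 1) g))) (letter_residues k g)"
    by (auto simp: surplus_words_def)
  let ?c = "ascents_after (k + 1) g"
  have c: "is_partition ?c" by (rule is_partition_ascents_after[OF x(2)])
  have f: "f (Suc i) \<le> f i" for i using x(3) unfolding is_partition_iff by blast
  have "f (Suc i) + ?c (Suc i) + (if Suc i \<in> ascents (k + 1) g then 1 else 0) \<le> f i + ?c i" for i
    using ascents_after_Suc[OF x(2), of i] f[of i] by linarith
  then show "(case x of (g, M, f) \<Rightarrow> (M + card (ascents (k + 1) g), \<lambda>i. f i + ascents_after (k + 1) g i, g))
      \<in> levelled_words k C"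
    using x partition_add[OF x(3) c] psize_ascents_after[OF x(2)] ascents_after_0[of "k + 1" g]
    by (simp add: levelled_words_def)
  show "(case case x of (g, M, f) \<Rightarrow> (M + card (ascents (k + 1) g), \<lambda>i. f i + ascents_after (k + 1) g i, g)
      of (M, f, g) \<Rightarrow> (g, M - card (ascents (k + 1) g), \<lambda>i. f i - ascents_after (k + 1) g i)) = x"
    using x(1) by simp
next
  fix x assume "x \<in> levelled_words k C"
  then obtain g M f where x: "x = (M, f, g)" "g \<in> padded_words (k + 1)" "is_partition f" "f 0 \<le> M"
    "\<And>i. f (Suc i) + (if Suc i \<in> ascents (k + 1) g then 1 else 0) \<le> f i"
    "C M (k * psize f) (letter_residues k g)"
    by (auto simp: levelled_words_def)
  let ?c = "ascents_after (k + 1) g" and ?f = "\<lambda>i. f i - ascents_after (k + 1) g i"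
  have c: "is_partition ?c" by (rule is_partition_ascents_after[OF x(2)])
  have le: "?c i \<le> f i" and part: "is_partition ?f" for i
    using partition_diff[OF x(3) ascents_after_Suc[OF x(2)] x(5) c] by blast+
  have f: "(\<lambda>i. ?f i + ?c i) = f" using le by simp
  have size: "psize f = psize ?f + \<Sum>(ascents (k + 1) g)"
    using partition_add(2)[OF part c] psize_ascents_after[OF x(2)] unfolding f by simp
  have c0: "?c 0 = card (ascents (k + 1) g)" by (rule ascents_after_0)
  have M: "card (ascents (k + 1) g) \<le> M" using c0 le[of 0] x(4) by simp
  have "?f 0 \<le> M - card (ascents (k + 1) g)" using c0 x(4) by simp
  then show "(case x of (M, f, g) \<Rightarrow> (g, M - card (ascents (k + 1) g), \<lambda>i. f i - ascents_after (k + 1) g i))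
      \<in> surplus_words k C"
    using x(1,2,6) part M by (simp add: surplus_words_def size)
  show "(case case x of (M, f, g) \<Rightarrow> (g, M - card (ascents (k + 1) g), \<lambda>i. f i - ascents_after (k + 1) g i)
      of (g, M, f) \<Rightarrow> (M + card (ascents (k + 1) g), \<lambda>i. f i + ascents_after (k + 1) g i, g)) = x"
    using x(1) M f by simp
qed

section \<open>Words with levels and semistrict partitions\<close>

text \<open>
  The number \<open>f (k + 1) + g - (k + 1)\<close> encodes a level \<open>f\<close> and a letter \<open>g \<in> {1..k + 1}\<close> in
  lexicographic order. The smallest pair in use, level 0 with letter \<open>k + 1\<close>, gets the number 0, so
  that an eventually constant word becomes an eventually vanishing sequence.
\<close>
lemma div_mod_level_code:
  fixes f g k :: nat
  assumes "1 \<le> g" "g \<le> k + 1" "f = 0 \<longrightarrow> g = k + 1"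
  defines "y \<equiv> f * (k + 1) + g - (k + 1)"
  shows "y + k = f * (k + 1) + (g - 1)" "(y + k) div (k + 1) = f" "(y + k) mod (k + 1) + 1 = g"
    "(k + 1) dvd y \<longleftrightarrow> g = k + 1" "g \<noteq> k + 1 \<Longrightarrow> y mod (k + 1) = g"
proof -
  show yk: "y + k = f * (k + 1) + (g - 1)"
    using assms(1-3) by (cases f) (auto simp: y_def)
  have "g - 1 < k + 1" using assms(1,2) by simp
  moreover have "(f * K + r) div K = f" "(f * K + r) mod K = r" if "r < K" for r K
    using that by simp_all
  ultimately show "(y + k) div (k + 1) = f" "(y + k) mod (k + 1) + 1 = g"
    unfolding yk using assms(1) by (metis, metis le_add_diff_inverse2)
  have y: "y + (k + 1) = f * (k + 1) + g" using yk assms(1) by simp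
  have "y mod (k + 1) = (y + (k + 1)) mod (k + 1)" by (rule mod_add_self2[symmetric])
  also have "\<dots> = g mod (k + 1)" unfolding y by (rule mod_mult_self3)
  finally have 2: "y mod (k + 1) = g mod (k + 1)" .
  then show "(k + 1) dvd y \<longleftrightarrow> g = k + 1" 
    using assms(1,2) by (cases "g = k + 1") (auto simp: dvd_eq_mod_eq_0)
  show "y mod (k + 1) = g" if "g \<noteq> k + 1" using 2 that assms(2) by simp
qed

lemma div_mod_decode:
  fixes y k :: nat
  shows "((y + k) div (k + 1)) * (k + 1) + ((y + k) mod (k + 1) + 1) - (k + 1) = y"
    "(y + k) div (k + 1) = 0 \<longrightarrow> (y + k) mod (k + 1) + 1 = k + 1"
proof -
  have "((y + k) div (k + 1)) * (k + 1) + (y + k) mod (k + 1) = y + k" by (rule div_mult_mod_eq)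
  then show "((y + k) div (k + 1)) * (k + 1) + ((y + k) mod (k + 1) + 1) - (k + 1) = y" by linarith
  show "(y + k) div (k + 1) = 0 \<longrightarrow> (y + k) mod (k + 1) + 1 = k + 1"
  proof
    assume *: "(y + k) div (k + 1) = 0"
    have "y = 0"
    proof (rule ccontr)
      assume "y \<noteq> 0"
      then have "(k + 1) div (k + 1) \<le> (y + k) div (k + 1)" by (intro div_le_mono) simp
      with * show False by simp
    qed
    then show "(y + k) mod (k + 1) + 1 = k + 1" by simp
  qed
qed

definition level_code :: "nat \<Rightarrow> (nat \<Rightarrow> nat) \<Rightarrow> (nat \<Rightarrow> nat) \<Rightarrow> nat \<Rightarrow> nat" where
  "level_code k f g i = f i * (k + 1) + g i - (k + 1)"

text \<open>
  The condition that the levels drop at ascents says exactly that the codes decrease, strictly so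
  unless the letter is \<open>k + 1\<close>: at equal levels the absence of an ascent means that the letter becomes
  smaller or stays equal to \<open>k + 1\<close>.
\<close>
lemma level_code_step:
  fixes f g f' g' k :: nat
  assumes "1 \<le> g" "g \<le> k + 1" "f = 0 \<longrightarrow> g = k + 1"
    and "1 \<le> g'" "g' \<le> k + 1" "f' = 0 \<longrightarrow> g' = k + 1"
  shows "f' + (if g < g' \<or> g = g' \<and> g' < k + 1 then 1 else 0) \<le> f \<longleftrightarrow>
    f' * (k + 1) + g' - (k + 1) \<le> f * (k + 1) + g - (k + 1) \<and>
    (g \<noteq> k + 1 \<longrightarrow> f' * (k + 1) + g' - (k + 1) < f * (k + 1) + g - (k + 1))"
proof -
  define y y' where "y = f * (k + 1) + g - (k + 1)" and "y' = f' * (k + 1) + g' - (k + 1)"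
  have "y + k = f * (k + 1) + (g - 1)" unfolding y_def by (rule div_mod_level_code(1)[OF assms(1-3)])
  then have y: "y + (k + 1) = f * (k + 1) + g" using assms(1) by linarith
  have "y' + k = f' * (k + 1) + (g' - 1)" unfolding y'_def by (rule div_mod_level_code(1)[OF assms(4-6)])
  then have y': "y' + (k + 1) = f' * (k + 1) + g'" using assms(4) by linarith
  have "f' + (if g < g' \<or> g = g' \<and> g' < k + 1 then 1 else 0) \<le> f \<longleftrightarrow>
    y' \<le> y \<and> (g \<noteq> k + 1 \<longrightarrow> y' < y)"
  proof (cases f' f rule: linorder_cases)
    case equal
    then have "y + g' = y' + g" using y y' unfolding equal by linarith
    then show ?thesis using equal assms(2,5) by auto
  next
    case less
    then have "Suc f' * (k + 1) \<le> f * (k + 1)" by (intro mult_right_mono) auto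
    then have "y' < y" using assms(1,5) y y' unfolding mult_Suc by linarith
    then show ?thesis using less by auto
  next
    case greater
    then have "Suc f * (k + 1) \<le> f' * (k + 1)" by (intro mult_right_mono) auto
    then have "y < y'" using assms(2,4) y y' unfolding mult_Suc by linarith
    then show ?thesis using greater by auto
  qed
  then show ?thesis by (simp only: y_def y'_def)
qed

text \<open>
  The codes of the levelled words: partitions in which only multiples of \<open>m\<close> may be repeated.
\<close>
definition semistrict :: "nat \<Rightarrow> (nat \<Rightarrow> nat) \<Rightarrow> bool" where
  "semistrict m y \<longleftrightarrow> is_partition y \<and> (\<forall>i. \<not> m dvd y i \<longrightarrow> y (Suc i) < y i)"

definition semistrict_partitions :: "nat \<Rightarrow> (nat \<Rightarrow> nat \<Rightarrow> nat multiset \<Rightarrow> bool) \<Rightarrow>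
    (nat \<times> (nat \<Rightarrow> nat)) set" where
  "semistrict_partitions k C = {(M, y). semistrict (k + 1) y \<and> y 0 \<le> (k + 1) * M \<and>
     C M (k * psize (\<lambda>i. (y i + k) div (k + 1)))
       (image_mset (\<lambda>i. y i mod (k + 1) mod k) (mset_set {i. \<not> (k + 1) dvd y i}))}"

lemma Suc_in_ascents:
  "Suc i \<in> ascents m g \<longleftrightarrow> g i < g (Suc i) \<or> g i = g (Suc i) \<and> g (Suc i) < m"
  by (simp add: ascents_def)

text \<open>
  The levels dominate the numbers of later ascents, so that no ascent follows a position of level 0.
\<close>
lemma ascents_after_level_0:
  assumes "g \<in> padded_words m" "is_partition f"
    and "\<And>i. f (Suc i) + (if Suc i \<in> ascents m g then 1 else 0) \<le> f i" "f i = 0"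
  shows "g i = m"
proof (rule ascents_after_eq_0[OF assms(1)])
  have "ascents_after m g i \<le> f i"
    using partition_diff(1)[OF assms(2) ascents_after_Suc[OF assms(1)] assms(3)
        is_partition_ascents_after[OF assms(1)]] .
  then show "ascents_after m g i = 0" using assms(4) by simp
qed

lemma levelled_words_eqpoll_semistrict_partitions:
  "levelled_words k C \<approx> semistrict_partitions k C"
proof (rule eqpoll_byWitness[where
    f = "\<lambda>(M, f, g). (M, level_code k f g)" and
    g = "\<lambda>(M, y). (M, \<lambda>i. (y i + k) div (k + 1), \<lambda>i. (y i + k) mod (k + 1) + 1)"])
  let ?decode = "\<lambda>(M, y). (M, \<lambda>i. (y i + k) div (k + 1), \<lambda>i. (y i + k) mod (k + 1) + 1)"
  fix x assume "x \<in> levelled_words k C"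
  then obtain g M f where x: "x = (M, f, g)" "g \<in> padded_words (k + 1)" "is_partition f" "f 0 \<le> M"
    and step: "\<And>i. f (Suc i) + (if Suc i \<in> ascents (k + 1) g then 1 else 0) \<le> f i"
    and C: "C M (k * psize f) (letter_residues k g)"
    by (auto simp: levelled_words_def)
  let ?y = "level_code k f g"
  have g: "1 \<le> g i" "g i \<le> k + 1" "f i = 0 \<longrightarrow> g i = k + 1" for i
    using padded_wordsD[OF x(2)] ascents_after_level_0[OF x(2,3) step] by blast+
  note code = div_mod_level_code[OF g, folded level_code_def]
  have mono: "?y (Suc i) \<le> ?y i \<and> (g i \<noteq> k + 1 \<longrightarrow> ?y (Suc i) < ?y i)" for i
    using level_code_step[OF g[of i] g[of "Suc i"]] step[of i] unfolding Suc_in_ascents level_code_def by blast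
  obtain n where n: "\<And>i. i \<ge> n \<Longrightarrow> f i = 0" using x(3) unfolding is_partition_iff by blast
  have "?y i = 0" if "i \<ge> n" for i using n[OF that] g(3)[of i] by (simp add: level_code_def)
  then have "is_partition ?y" using mono unfolding is_partition_iff by blast
  then have semi: "semistrict (k + 1) ?y" using mono code(4) unfolding semistrict_def by blast
  have "?y 0 + k = f 0 * (k + 1) + (g 0 - 1)" by (rule code(1))
  also have "\<dots> \<le> M * (k + 1) + k" using x(4) g(2)[of 0] by (intro add_mono mult_right_mono) auto
  finally have bound: "?y 0 \<le> (k + 1) * M" by (simp only: mult.commute add_le_cancel_right)
  have f_eq: "(\<lambda>i. (?y i + k) div (k + 1)) = f" using code(2) by blast
  have g_eq: "(\<lambda>i. (?y i + k) mod (k + 1) + 1) = g" using code(3) by blast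
  have dvd_iff: "{i. \<not> (k + 1) dvd ?y i} = {i. g i \<noteq> k + 1}" using code(4) by blast
  have "image_mset (\<lambda>i. ?y i mod (k + 1) mod k) (mset_set {i. g i \<noteq> k + 1}) = letter_residues k g"
    unfolding letter_residues_def
  proof (rule image_mset_cong)
    fix i assume "i \<in># mset_set {i. g i \<noteq> k + 1}"
    then have "g i \<noteq> k + 1" using padded_wordsD(3)[OF x(2)] by simp
    then show "?y i mod (k + 1) mod k = g i mod k" using code(5) by simp
  qed
  then show "(case x of (M, f, g) \<Rightarrow> (M, level_code k f g)) \<in> semistrict_partitions k C"
    using x(1) semi bound C unfolding semistrict_partitions_def
    by (simp only: f_eq dvd_iff prod.case mem_Collect_eq simp_thms)
  show "?decode (case x of (M, f, g) \<Rightarrow> (M, level_code k f g)) = x"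
    by (simp only: x(1) prod.case f_eq g_eq)
next
  let ?decode = "\<lambda>(M, y). (M, \<lambda>i. (y i + k) div (k + 1), \<lambda>i. (y i + k) mod (k + 1) + 1)"
  fix x assume "x \<in> semistrict_partitions k C"
  then obtain M y where x: "x = (M, y)" "semistrict (k + 1) y" "y 0 \<le> (k + 1) * M"
    and C: "C M (k * psize (\<lambda>i. (y i + k) div (k + 1)))
       (image_mset (\<lambda>i. y i mod (k + 1) mod k) (mset_set {i. \<not> (k + 1) dvd y i}))"
    unfolding semistrict_partitions_def by blast
  define f where "f i = (y i + k) div (k + 1)" for i
  define g where "g i = (y i + k) mod (k + 1) + 1" for i
  have g: "1 \<le> g i" "g i \<le> k + 1" "f i = 0 \<longrightarrow> g i = k + 1" for i
  proof -
    have "(y i + k) mod (k + 1) < k + 1" by (rule mod_less_divisor) simp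
    then show "1 \<le> g i" "g i \<le> k + 1" by (auto simp: g_def)
    show "f i = 0 \<longrightarrow> g i = k + 1" unfolding f_def g_def by (rule div_mod_decode(2))
  qed
  have y_eq: "level_code k f g = y"
    unfolding level_code_def f_def g_def by (rule ext) (rule div_mod_decode(1))
  note code = div_mod_level_code[OF g, folded level_code_def, unfolded y_eq]
  have y: "is_partition y" using x(2) by (simp add: semistrict_def)
  have dvd_iff: "{i. \<not> (k + 1) dvd y i} = {i. g i \<noteq> k + 1}" using code(4) by blast
  have "finite {i. g i \<noteq> k + 1}"
  proof (rule finite_subset)
    show "{i. g i \<noteq> k + 1} \<subseteq> part_indices y"
      unfolding dvd_iff[symmetric] part_indices_def by (metis (mono_tags, lifting) dvd_0_right mem_Collect_eq subsetI)
    show "finite (part_indices y)" using y by (simp add: is_partition_def)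
  qed
  then have pw: "g \<in> padded_words (k + 1)" using g(1,2) by (auto simp: padded_words_def)
  have step: "f (Suc i) + (if Suc i \<in> ascents (k + 1) g then 1 else 0) \<le> f i" for i
  proof -
    have "y (Suc i) \<le> y i" using y unfolding is_partition_iff by blast
    moreover have "g i \<noteq> k + 1 \<longrightarrow> y (Suc i) < y i" using x(2) code(4) unfolding semistrict_def by blast
    ultimately show ?thesis
      using level_code_step[OF g[of i] g[of "Suc i"], folded level_code_def, unfolded y_eq]
      unfolding Suc_in_ascents by blast
  qed
  obtain n where "\<And>i. i \<ge> n \<Longrightarrow> y i = 0" using y unfolding is_partition_iff by blast
  then have "\<forall>i\<ge>n. f i = 0" by (simp add: f_def)
  then have part: "is_partition f" using step add_leE unfolding is_partition_iff by blast
  have "f 0 \<le> ((k + 1) * M + k) div (k + 1)" unfolding f_def using x(3) by (intro div_le_mono) simp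
  also have "\<dots> = M + k div (k + 1)" by (rule div_mult_self4) simp
  also have "\<dots> = M" by simp
  finally have bound: "f 0 \<le> M" .
  have "image_mset (\<lambda>i. y i mod (k + 1) mod k) (mset_set {i. g i \<noteq> k + 1}) = letter_residues k g"
    unfolding letter_residues_def
  proof (rule image_mset_cong)
    fix i assume "i \<in># mset_set {i. g i \<noteq> k + 1}"
    then have "g i \<noteq> k + 1" using padded_wordsD(3)[OF pw] by simp
    then show "y i mod (k + 1) mod k = g i mod k" using code(5) by simp
  qed
  then have "C M (k * psize f) (letter_residues k g)"
    using C unfolding dvd_iff f_def[symmetric] by simp
  moreover have "?decode x = (M, f, g)" by (simp only: x(1) prod.case f_def[abs_def] g_def[abs_def])
  ultimately show "?decode x \<in> levelled_words k C"
    using pw part bound step unfolding levelled_words_def by simp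
  show "(case ?decode x of (M, f, g) \<Rightarrow> (M, level_code k f g)) = x"
    using \<open>?decode x = (M, f, g)\<close> y_eq x(1) by simp
qed

definition semistrict_msets :: "nat \<Rightarrow> (nat \<Rightarrow> nat \<Rightarrow> nat multiset \<Rightarrow> bool) \<Rightarrow>
    (nat \<times> nat multiset) set" where
  "semistrict_msets k C = {(M, P). set_mset P \<subseteq> {1..(k + 1) * M} \<and>
     (\<forall>x. \<not> (k + 1) dvd x \<longrightarrow> count P x \<le> 1) \<and>
     C M (k * (\<Sum>x\<in>#P. (x + k) div (k + 1)))
       (image_mset (\<lambda>x. x mod (k + 1) mod k) (filter_mset (\<lambda>x. \<not> (k + 1) dvd x) P))}"

text \<open>
  Every condition on a semistrict partition, and its weight, can be expressed by the multiset of its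
  parts.
\<close>
lemma semistrict_parts_mset:
  assumes y: "is_partition y"
  shows "(M, y) \<in> semistrict_partitions k C \<longleftrightarrow> (M, parts_mset y) \<in> semistrict_msets k C"
proof -
  let ?D = "\<lambda>x. \<not> (k + 1) dvd x"
  have D: "?D x \<Longrightarrow> x \<noteq> 0" for x by (metis dvd_0_right)
  have 1: "semistrict (k + 1) y \<longleftrightarrow> (\<forall>x. ?D x \<longrightarrow> count (parts_mset y) x \<le> 1)"
    using count_parts_mset_le_1[OF y] D y unfolding semistrict_def by metis
  have idx: "part_indices (\<lambda>i. (y i + k) div (k + 1)) = part_indices y"
    unfolding part_indices_def by (rule Collect_cong) (simp add: div_eq_0_iff)
  have 2: "psize (\<lambda>i. (y i + k) div (k + 1)) = (\<Sum>x\<in>#parts_mset y. (x + k) div (k + 1))"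
    unfolding psize_def idx by (simp add: parts_mset_def sum_unfold_sum_mset multiset.map_comp comp_def)
  have "filter_mset ?D (parts_mset y) = image_mset y (mset_set {i. ?D (y i)})"
    by (rule filter_parts_mset[OF y D])
  then have 3: "image_mset (\<lambda>x. x mod (k + 1) mod k) (filter_mset ?D (parts_mset y)) =
      image_mset (\<lambda>i. y i mod (k + 1) mod k) (mset_set {i. ?D (y i)})"
    by (simp only: multiset.map_comp comp_def)
  show ?thesis
    unfolding semistrict_partitions_def semistrict_msets_def mem_Collect_eq prod.case
      1 2 3 parts_mset_bound[OF y] by blast
qed

lemma semistrict_partitions_eqpoll_semistrict_msets: "semistrict_partitions k C \<approx> semistrict_msets k C"
proof -
  have "bij_betw (\<lambda>(M, y). (M, parts_mset y)) (semistrict_partitions k C) (semistrict_msets k C)"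
    unfolding bij_betw_def
  proof
    have part: "is_partition y" if "(M, y) \<in> semistrict_partitions k C" for M y
      using that by (auto simp: semistrict_partitions_def semistrict_def)
    show "inj_on (\<lambda>(M, y). (M, parts_mset y)) (semistrict_partitions k C)"
      by (rule inj_onI) (auto dest: part intro: partition_eqI)
    show "(\<lambda>(M, y). (M, parts_mset y)) ` semistrict_partitions k C = semistrict_msets k C"
    proof (intro equalityI subsetI)
      fix z assume "z \<in> (\<lambda>(M, y). (M, parts_mset y)) ` semistrict_partitions k C"
      then obtain M y where z: "z = (M, parts_mset y)" and y: "(M, y) \<in> semistrict_partitions k C" by auto
      then show "z \<in> semistrict_msets k C" using semistrict_parts_mset[OF part[OF y]] by simp
    next
      fix z assume z: "z \<in> semistrict_msets k C"
      obtain M P where MP: "z = (M, P)" by (cases z)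
      have "0 \<notin># P" using z MP by (auto simp: semistrict_msets_def)
      then obtain y where y: "is_partition y" "parts_mset y = P" using partition_with_parts by blast
      then have "(M, y) \<in> semistrict_partitions k C" using z MP semistrict_parts_mset by simp
      then show "z \<in> (\<lambda>(M, y). (M, parts_mset y)) ` semistrict_partitions k C" using y MP by force
    qed
  qed
  then show ?thesis unfolding eqpoll_def by blast
qed

section \<open>Splitting a semistrict partition into two\<close>

text \<open>
  The order-preserving enumeration of the positive numbers that are not multiples of \<open>k + 1\<close>: it sends
  \<open>k q + c\<close> to \<open>(k + 1) q + c\<close> for \<open>1 \<le> c \<le> k\<close>. Its inverse is \<open>squeeze\<close>.
\<close>
definition spread :: "nat \<Rightarrow> nat \<Rightarrow> nat" where
  "spread k s = s + (s - 1) div k"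

definition squeeze :: "nat \<Rightarrow> nat \<Rightarrow> nat" where
  "squeeze k x = x - x div (k + 1)"

lemma spread_cases:
  assumes "k \<ge> 1" "s \<ge> 1"
  obtains q r where "s = q * k + Suc r" "r < k"
proof -
  have "s = ((s - 1) div k) * k + Suc ((s - 1) mod k)" using assms by simp
  moreover have "(s - 1) mod k < k" using assms by simp
  ultimately show ?thesis by (rule that)
qed

lemma spread_eq:
  assumes "r < k"
  shows "spread k (q * k + Suc r) = q * (k + 1) + Suc r"
proof -
  have "(q * k + Suc r - 1) div k = q" using assms by simp
  then show ?thesis by (simp add: spread_def)
qed

lemma div_mod_succ:
  fixes q r k :: nat
  assumes "r < k"
  shows "(q * (k + 1) + Suc r) div (k + 1) = q" "(q * (k + 1) + Suc r) mod (k + 1) = Suc r"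
    "(q * (k + 1) + Suc r + k) div (k + 1) = Suc q"
proof -
  have *: "(q * K + x) div K = q" "(q * K + x) mod K = x" if "x < K" for q K x :: nat
    using that by simp_all
  show "(q * (k + 1) + Suc r) div (k + 1) = q" "(q * (k + 1) + Suc r) mod (k + 1) = Suc r"
    using *[of "Suc r" "k + 1" q] assms by simp_all
  have eq: "q * (k + 1) + Suc r + k = Suc q * (k + 1) + r" by simp
  have "r < k + 1" using assms by simp
  then show "(q * (k + 1) + Suc r + k) div (k + 1) = Suc q"
    unfolding eq by (rule *(1))
qed

lemma spread_props:
  assumes "k \<ge> 1" "s \<ge> 1"
  shows "squeeze k (spread k s) = s" "\<not> (k + 1) dvd spread k s" "spread k s \<ge> 1"
    "spread k s mod (k + 1) mod k = s mod k"
    "k * ((spread k s + k) div (k + 1)) = s + (if s mod k = 0 then 0 else k - s mod k)"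
    "s \<le> k * M \<longleftrightarrow> spread k s \<le> (k + 1) * M"
proof -
  obtain q r where s: "s = q * k + Suc r" and r: "r < k" using spread_cases[OF assms] .
  have sp: "spread k s = q * (k + 1) + Suc r" using spread_eq[OF r] s by simp
  note dm = div_mod_succ[OF r, of q]
  show "squeeze k (spread k s) = s" unfolding squeeze_def sp dm(1) by (simp add: s)
  show "\<not> (k + 1) dvd spread k s" unfolding sp dvd_eq_mod_eq_0 dm(2) by simp
  show "spread k s \<ge> 1" by (simp add: sp)
  have smod: "s mod k = Suc r mod k" unfolding s by simp
  then show "spread k s mod (k + 1) mod k = s mod k" unfolding sp dm(2) by simp
  show "k * ((spread k s + k) div (k + 1)) = s + (if s mod k = 0 then 0 else k - s mod k)"
    unfolding sp dm(3) smod using r s by (cases "Suc r = k") (auto simp: algebra_simps)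
  have "s \<le> k * M \<longleftrightarrow> q < M"
  proof
    assume "s \<le> k * M"
    then have "q * k < M * k" using s unfolding mult.commute[of k M] by linarith
    then show "q < M" using mult_less_cancel2 by blast
  next
    assume "q < M"
    then have "Suc q * k \<le> M * k" by (intro mult_right_mono) auto
    then show "s \<le> k * M" using s r by (simp add: mult.commute)
  qed
  moreover have "spread k s \<le> (k + 1) * M \<longleftrightarrow> q < M"
  proof
    assume "spread k s \<le> (k + 1) * M"
    then have "q * (k + 1) < M * (k + 1)" unfolding sp mult.commute[of "k + 1" M] by linarith
    then show "q < M" using mult_less_cancel2 by blast
  next
    assume "q < M"
    then have "Suc q * (k + 1) \<le> M * (k + 1)" by (intro mult_right_mono) auto
    then show "spread k s \<le> (k + 1) * M" unfolding sp using r by (simp add: algebra_simps)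
  qed
  ultimately show "s \<le> k * M \<longleftrightarrow> spread k s \<le> (k + 1) * M" by simp
qed

lemma spread_squeeze:
  assumes "k \<ge> 1" "\<not> (k + 1) dvd x"
  shows "spread k (squeeze k x) = x" "squeeze k x \<ge> 1"
proof -
  define q c where "q = x div (k + 1)" and "c = x mod (k + 1)"
  have "c \<noteq> 0" using assms(2) by (auto simp: c_def dvd_eq_mod_eq_0)
  then obtain r where c: "c = Suc r" by (cases c) auto
  have "c < k + 1" unfolding c_def by (rule mod_less_divisor) simp
  then have r: "r < k" using c by simp
  have "q * (k + 1) + c = x" unfolding q_def c_def by (rule div_mult_mod_eq)
  then have x: "x = q * (k + 1) + Suc r" using c by simp
  have "squeeze k x = q * k + Suc r" unfolding squeeze_def x div_mod_succ(1)[OF r] by simp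
  then show "spread k (squeeze k x) = x" "squeeze k x \<ge> 1" using spread_eq[OF r, of q] x by simp_all
qed

text \<open>
  The semistrict multiset whose multiples of \<open>k + 1\<close> come from \<open>E\<close> and whose other elements come from
  \<open>S\<close>.
\<close>
definition merge :: "nat \<Rightarrow> nat multiset \<Rightarrow> nat set \<Rightarrow> nat multiset" where
  "merge k E S = image_mset (\<lambda>e. (k + 1) * e) E + mset_set (spread k ` S)"

lemma inj_on_spread:
  assumes "k \<ge> 1" "S \<subseteq> {1..}"
  shows "inj_on (spread k) S"
  by (rule inj_on_inverseI[where g = "squeeze k"]) (use assms spread_props(1) in auto)

lemma filter_merge:
  assumes "k \<ge> 1" "finite S" "S \<subseteq> {1..}"
  shows "filter_mset (\<lambda>x. (k + 1) dvd x) (merge k E S) = image_mset (\<lambda>e. (k + 1) * e) E"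
    "filter_mset (\<lambda>x. \<not> (k + 1) dvd x) (merge k E S) = mset_set (spread k ` S)"
proof -
  have nd: "\<not> (k + 1) dvd x" if "x \<in># mset_set (spread k ` S)" for x
    using that assms spread_props(2) by (auto simp: subset_iff)
  have d: "(k + 1) dvd x" if "x \<in># image_mset (\<lambda>e. (k + 1) * e) E" for x
    using that unfolding set_image_mset by (elim imageE) (simp only: dvd_triv_left)
  have all: "filter_mset P A = A" if "\<And>x. x \<in># A \<Longrightarrow> P x" for P and A :: "nat multiset"
    using that filter_mset_cong[of A A P "\<lambda>_. True"] by simp
  have none: "filter_mset P A = {#}" if "\<And>x. x \<in># A \<Longrightarrow> \<not> P x" for P and A :: "nat multiset"
    using that filter_mset_cong[of A A P "\<lambda>_. False"] by simp
  show "filter_mset (\<lambda>x. (k + 1) dvd x) (merge k E S) = image_mset (\<lambda>e. (k + 1) * e) E"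
    unfolding merge_def filter_union_mset
    by (subst all, erule d, subst none, erule nd, rule add.right_neutral)
  show "filter_mset (\<lambda>x. \<not> (k + 1) dvd x) (merge k E S) = mset_set (spread k ` S)"
    unfolding merge_def filter_union_mset
    by (subst none, unfold not_not, erule d, subst all, erule nd, rule add.left_neutral)
qed

text \<open>
  Each element of the merged multiset has as its level the quotient by \<open>k + 1\<close>, rounded up. For an
  element that comes from \<open>s \<in> S\<close> this is also \<open>s\<close> divided by \<open>k\<close> and rounded up, and \<open>k\<close> times it
  exceeds \<open>s\<close> by the defect of its residue.
\<close>
lemma weight_merge:
  assumes "k \<ge> 1" "finite S" "S \<subseteq> {1..}"
  shows "k * (\<Sum>x\<in>#merge k E S. (x + k) div (k + 1)) =
      k * \<Sum>\<^sub># E + \<Sum>S + residue_defect k (residues k S)"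
    "image_mset (\<lambda>x. x mod (k + 1) mod k) (filter_mset (\<lambda>x. \<not> (k + 1) dvd x) (merge k E S)) = residues k S"
proof -
  have ms: "mset_set (spread k ` S) = image_mset (spread k) (mset_set S)"
    using inj_on_spread[OF assms(1,3)] by (simp add: image_mset_mset_set)
  have s: "s \<ge> 1" if "s \<in> S" for s using assms(3) that by auto
  have "((k + 1) * e + k) div (k + 1) = e" for e
  proof -
    have "((k + 1) * e + k) div (k + 1) = e + k div (k + 1)" by (rule div_mult_self4) simp
    then show ?thesis by simp
  qed
  then have "(\<Sum>x\<in>#merge k E S. (x + k) div (k + 1)) = \<Sum>\<^sub># E + (\<Sum>s\<in>S. (spread k s + k) div (k + 1))"
    unfolding merge_def ms by (simp only: image_mset_union sum_mset.union multiset.map_comp comp_def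
      multiset.map_ident sum_unfold_sum_mset)
  then have "k * (\<Sum>x\<in>#merge k E S. (x + k) div (k + 1)) =
      k * \<Sum>\<^sub># E + (\<Sum>s\<in>S. k * ((spread k s + k) div (k + 1)))"
    by (simp only: distrib_left sum_distrib_left)
  also have "(\<Sum>s\<in>S. k * ((spread k s + k) div (k + 1))) =
      (\<Sum>s\<in>S. s + (if s mod k = 0 then 0 else k - s mod k))"
    by (rule sum.cong[OF refl]) (rule spread_props(5)[OF assms(1) s])
  also have "\<dots> = \<Sum>S + residue_defect k (residues k S)"
    by (simp add: sum.distrib residue_defect_def residues_def multiset.map_comp comp_def sum_unfold_sum_mset)
  finally show "k * (\<Sum>x\<in>#merge k E S. (x + k) div (k + 1)) =
      k * \<Sum>\<^sub># E + \<Sum>S + residue_defect k (residues k S)" by simp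
  show "image_mset (\<lambda>x. x mod (k + 1) mod k) (filter_mset (\<lambda>x. \<not> (k + 1) dvd x) (merge k E S)) = residues k S"
    unfolding filter_merge(2)[OF assms] ms residues_def multiset.map_comp
    by (rule image_mset_cong) (use spread_props(4)[OF assms(1) s] assms(2) in simp)
qed

lemma windowed_eqpoll_semistrict_msets:
  assumes k: "k \<ge> 1"
  shows "windowed k 1 1 (\<lambda>m n a. C m (n + residue_defect k a) a) \<approx> semistrict_msets k C"
proof (rule eqpoll_byWitness[where f = "\<lambda>(M, E, S). (M, merge k E S)" and
    g = "\<lambda>(M, P). (M, image_mset (\<lambda>x. x div (k + 1)) (filter_mset (\<lambda>x. (k + 1) dvd x) P),
      squeeze k ` {x \<in> set_mset P. \<not> (k + 1) dvd x})"])
  let ?C = "\<lambda>m n a. C m (n + residue_defect k a) a"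
  let ?g = "\<lambda>(M, P). (M, image_mset (\<lambda>x. x div (k + 1)) (filter_mset (\<lambda>x. (k + 1) dvd x) P),
      squeeze k ` {x \<in> set_mset P. \<not> (k + 1) dvd x})"
  fix x assume "x \<in> windowed k 1 1 ?C"
  then obtain M E S where x: "x = (M, E, S)" and E: "set_mset E \<subseteq> {1..M}" and S: "S \<subseteq> {1..<1 + k * M}"
    and C: "C M (k * \<Sum>\<^sub># E + \<Sum>S + residue_defect k (residues k S)) (residues k S)"
    unfolding windowed_def by blast
  have fin: "finite S" using S finite_subset by blast
  have S1: "S \<subseteq> {1..}" using S by auto
  have "(k + 1) * e \<in> {1..(k + 1) * M}" if "e \<in># E" for e
  proof -
    have "1 \<le> e" "e \<le> M" using E that by auto
    then show ?thesis using mult_le_mono2[of e M "k + 1"] by simp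
  qed
  moreover have "spread k s \<in> {1..(k + 1) * M}" if "s \<in> S" for s
  proof -
    have "1 \<le> s" "s \<le> k * M" using S that by auto
    then show ?thesis using spread_props(3,6)[OF k] by simp
  qed
  ultimately have "set_mset (merge k E S) \<subseteq> {1..(k + 1) * M}"
    using fin unfolding merge_def by auto
  moreover have "count (merge k E S) y \<le> 1" if "\<not> (k + 1) dvd y" for y
  proof -
    have "count (merge k E S) y = count (filter_mset (\<lambda>x. \<not> (k + 1) dvd x) (merge k E S)) y"
      using that by simp
    also have "\<dots> \<le> 1" unfolding filter_merge(2)[OF k fin S1] by (simp add: count_mset_set')
    finally show ?thesis .
  qed
  ultimately show "(case x of (M, E, S) \<Rightarrow> (M, merge k E S)) \<in> semistrict_msets k C"
    using C unfolding semistrict_msets_def x by (simp only: weight_merge[OF k fin S1] prod.case mem_Collect_eq) blast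
  have "{y \<in> set_mset (merge k E S). \<not> (k + 1) dvd y} = spread k ` S"
    using arg_cong[OF filter_merge(2)[OF k fin S1, of E], of set_mset] fin by simp
  moreover have "squeeze k ` spread k ` S = S"
    using spread_props(1)[OF k] S1 by (force simp: image_image)
  moreover have "image_mset (\<lambda>x. x div (k + 1)) (image_mset (\<lambda>e. (k + 1) * e) E) = E"
  proof -
    have "(k + 1) * e div (k + 1) = e" for e by (rule nonzero_mult_div_cancel_left) simp
    then show ?thesis by (simp only: multiset.map_comp comp_def multiset.map_ident)
  qed
  ultimately show "?g (case x of (M, E, S) \<Rightarrow> (M, merge k E S)) = x"
    by (simp only: x prod.case filter_merge(1)[OF k fin S1])
next
  let ?C = "\<lambda>m n a. C m (n + residue_defect k a) a"
  fix z assume z: "z \<in> semistrict_msets k C"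
  obtain M P where MP: "z = (M, P)" by (cases z)
  have P: "set_mset P \<subseteq> {1..(k + 1) * M}" and cnt: "\<And>x. \<not> (k + 1) dvd x \<Longrightarrow> count P x \<le> 1"
    and C: "C M (k * (\<Sum>x\<in>#P. (x + k) div (k + 1)))
       (image_mset (\<lambda>x. x mod (k + 1) mod k) (filter_mset (\<lambda>x. \<not> (k + 1) dvd x) P))"
    using z unfolding MP semistrict_msets_def by blast+
  define E where "E = image_mset (\<lambda>x. x div (k + 1)) (filter_mset (\<lambda>x. (k + 1) dvd x) P)"
  define S where "S = squeeze k ` {x \<in> set_mset P. \<not> (k + 1) dvd x}"
  have fin: "finite S" by (simp add: S_def)
  have S1: "S \<subseteq> {1..}" using spread_squeeze(2)[OF k] by (auto simp: S_def)
  have spS: "spread k ` S = {x \<in> set_mset P. \<not> (k + 1) dvd x}"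
    using spread_squeeze(1)[OF k] unfolding S_def image_image by force
  have "image_mset (\<lambda>e. (k + 1) * e) E = filter_mset (\<lambda>x. (k + 1) dvd x) P"
  proof -
    have "image_mset (\<lambda>e. (k + 1) * e) E = image_mset (\<lambda>x. x) (filter_mset (\<lambda>x. (k + 1) dvd x) P)"
      unfolding E_def multiset.map_comp comp_def
      by (rule image_mset_cong) (use dvd_mult_div_cancel in force)
    then show ?thesis by simp
  qed
  moreover have "mset_set (spread k ` S) = filter_mset (\<lambda>x. \<not> (k + 1) dvd x) P"
  proof (rule multiset_eqI)
    fix x
    show "count (mset_set (spread k ` S)) x = count (filter_mset (\<lambda>x. \<not> (k + 1) dvd x) P) x"
    proof (cases "\<not> (k + 1) dvd x \<and> x \<in># P")
      case True
      then have "count P x = 1" using cnt[of x] by (metis count_greater_eq_one_iff le_antisym)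
      then show ?thesis using True unfolding spS by simp
    next
      case False
      then show ?thesis unfolding spS by (auto simp: not_in_iff)
    qed
  qed
  ultimately have PE: "merge k E S = P"
    unfolding merge_def by (metis multiset_partition)
  have "set_mset E \<subseteq> {1..M}"
  proof
    fix e assume "e \<in># E"
    then obtain x where x: "x \<in># P" "(k + 1) dvd x" "e = x div (k + 1)" by (auto simp: E_def)
    then have "(k + 1) * e = x" by (simp only: dvd_mult_div_cancel)
    moreover have "1 \<le> x" "x \<le> (k + 1) * M" using P x(1) by auto
    ultimately have *: "(k + 1) * e \<noteq> 0" "(k + 1) * e \<le> (k + 1) * M" by simp_all
    have "e \<noteq> 0" using *(1) by (intro notI) simp
    moreover have "e \<le> M" using *(2) by (subst (asm) mult_le_cancel1) simp
    ultimately show "e \<in> {1..M}" by simp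
  qed
  moreover have "S \<subseteq> {1..<1 + k * M}"
  proof
    fix s assume s: "s \<in> S"
    then have "spread k s \<in> set_mset P" using spS by blast
    then have "spread k s \<in> {1..(k + 1) * M}" using P by blast
    moreover have "1 \<le> s" using s S1 by auto
    ultimately have "spread k s \<le> (k + 1) * M" "1 \<le> s" by simp_all
    then show "s \<in> {1..<1 + k * M}" using spread_props(6)[OF k, of s M] by simp
  qed
  moreover have "?C M (k * \<Sum>\<^sub># E + \<Sum>S) (residues k S)"
    using C weight_merge[OF k fin S1, of E] unfolding PE by simp
  ultimately have "(M, E, S) \<in> windowed k 1 1 ?C" unfolding windowed_def by simp
  moreover have g: "(case z of (M, P) \<Rightarrow> (M, image_mset (\<lambda>x. x div (k + 1)) (filter_mset (\<lambda>x. (k + 1) dvd x) P),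
      squeeze k ` {x \<in> set_mset P. \<not> (k + 1) dvd x})) = (M, E, S)"
    by (simp add: MP E_def S_def)
  ultimately show "(case z of (M, P) \<Rightarrow> (M, image_mset (\<lambda>x. x div (k + 1)) (filter_mset (\<lambda>x. (k + 1) dvd x) P),
      squeeze k ` {x \<in> set_mset P. \<not> (k + 1) dvd x})) \<in> windowed k 1 1 ?C" by simp
  show "(case (case z of (M, P) \<Rightarrow> (M, image_mset (\<lambda>x. x div (k + 1)) (filter_mset (\<lambda>x. (k + 1) dvd x) P),
      squeeze k ` {x \<in> set_mset P. \<not> (k + 1) dvd x})) of (M, E, S) \<Rightarrow> (M, merge k E S)) = z"
    unfolding g by (simp add: PE MP)
qed

section \<open>Comparison of the two weighted sets\<close>

definition bounded_msets :: "(nat \<times> nat multiset) set" where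
  "bounded_msets = {(M, E). set_mset E \<subseteq> {1..M}}"

lemma finite_bounded_msets: "finite {E :: nat multiset. set_mset E \<subseteq> {1..M} \<and> \<Sum>\<^sub># E \<le> n}"
proof (rule finite_subset)
  show "{E. set_mset E \<subseteq> {1..M} \<and> \<Sum>\<^sub># E \<le> n} \<subseteq> mset ` {xs. set xs \<subseteq> {1..M} \<and> length xs \<le> n}"
  proof clarify
    fix E :: "nat multiset" assume E: "set_mset E \<subseteq> {1..M}" "\<Sum>\<^sub># E \<le> n"
    obtain xs where xs: "mset xs = E" using ex_mset by blast
    have "size E = (\<Sum>x\<in>#E. 1)" by (rule size_eq_sum_mset)
    also have "\<dots> \<le> (\<Sum>x\<in>#E. x)" using E(1) by (intro sum_mset_mono) auto
    finally have "length xs \<le> n" using E(2) xs by auto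
    then show "E \<in> mset ` {xs. set xs \<subseteq> {1..M} \<and> length xs \<le> n}" using E(1) xs by auto
  qed
  show "finite (mset ` {xs. set xs \<subseteq> {1..M} \<and> length xs \<le> n})"
    by (intro finite_imageI finite_lists_length_le) simp
qed

definition word_residues :: "nat \<Rightarrow> nat list \<Rightarrow> nat multiset" where
  "word_residues k w = image_mset (\<lambda>c. c mod k) (filter_mset (\<lambda>c. c \<noteq> k + 1) (mset w))"

lemma letter_residues_padded:
  "letter_residues k (padded (k + 1) w) = word_residues k w"
proof -
  have "mset w = image_mset (\<lambda>i. w ! i) (mset_set {..<length w})"
    by (metis lessThan_atLeast0 map_nth mset_map mset_upt)
  then have "word_residues k w =
      image_mset (\<lambda>i. w ! i mod k) (mset_set {i. i < length w \<and> w ! i \<noteq> k + 1})"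
    unfolding word_residues_def by (simp add: filter_mset_image_mset multiset.map_comp comp_def)
  also have "\<dots> = image_mset (\<lambda>i. padded (k + 1) w i mod k) (mset_set {i. i < length w \<and> w ! i \<noteq> k + 1})"
    by (rule image_mset_cong) (simp add: padded_def)
  also have "{i. i < length w \<and> w ! i \<noteq> k + 1} = {i. padded (k + 1) w i \<noteq> k + 1}"
    by (auto simp: padded_def)
  finally show ?thesis unfolding letter_residues_def ..
qed

lemma words_times_bounded_msets:
  "{(w, y). w \<in> words (k + 1) \<and> y \<in> bounded_msets \<and>
      C (asc_beta (k + 1) w + fst y) (k * comaj_beta (k + 1) w + k * \<Sum>\<^sub># (snd y)) (word_residues k w)}
    \<approx> surplus_words k C"
proof -
  define Q where "Q = (\<lambda>(w, M, E). set_mset E \<subseteq> {1..M} \<and>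
    C (asc_beta (k + 1) w + M) (k * comaj_beta (k + 1) w + k * \<Sum>\<^sub># E) (word_residues k w))"
  define R where "R = (\<lambda>(g, M, f). f 0 \<le> M \<and>
     C (M + card (ascents (k + 1) g)) (k * (psize f + \<Sum>(ascents (k + 1) g))) (letter_residues k g))"
  let ?parts = "map_prod id (map_prod id parts_mset) :: nat list \<times> nat \<times> (nat \<Rightarrow> nat) \<Rightarrow> _"
  let ?pad = "map_prod (padded (k + 1)) id :: nat list \<times> nat \<times> (nat \<Rightarrow> nat) \<Rightarrow> _"
  let ?I = "words (k + 1) \<times> UNIV \<times> {l. is_partition l}"
  have "bij_betw ?parts ?I (words (k + 1) \<times> UNIV \<times> {A. 0 \<notin># A})"
    by (intro bij_betw_map_prod bij_betw_id bij_parts_mset)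
  then have 1: "{x \<in> ?I. Q (?parts x)} \<approx> {x \<in> words (k + 1) \<times> UNIV \<times> {A. 0 \<notin># A}. Q x}"
    by (rule eqpoll_restrict)
  have "bij_betw ?pad ?I (padded_words (k + 1) \<times> UNIV \<times> {l. is_partition l})"
    by (intro bij_betw_map_prod bij_betw_id bij_padded) simp
  then have 2: "{x \<in> ?I. R (?pad x)} \<approx> {x \<in> padded_words (k + 1) \<times> UNIV \<times> {l. is_partition l}. R x}"
    by (rule eqpoll_restrict)
  have "Q (?parts x) \<longleftrightarrow> R (?pad x)" if "x \<in> ?I" for x
  proof -
    obtain w M f where x: "x = (w, M, f)" by (rule prod_cases3)
    have w: "w \<in> words (k + 1)" and f: "is_partition f" using that x by auto
    show ?thesis
      unfolding Q_def R_def x map_prod_simp id_apply prod.case parts_mset_bound[OF f] sum_parts_mset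
        ascents_padded[OF w] letter_residues_padded asc_beta_def comaj_beta_def
      by (simp add: add.commute distrib_left)
  qed
  then have "{x \<in> ?I. Q (?parts x)} = {x \<in> ?I. R (?pad x)}" by blast
  moreover have "{x \<in> words (k + 1) \<times> UNIV \<times> {A. 0 \<notin># A}. Q x} =
    {(w, y). w \<in> words (k + 1) \<and> y \<in> bounded_msets \<and>
      C (asc_beta (k + 1) w + fst y) (k * comaj_beta (k + 1) w + k * \<Sum>\<^sub># (snd y)) (word_residues k w)}"
    by (auto simp: Q_def bounded_msets_def)
  moreover have "{x \<in> padded_words (k + 1) \<times> UNIV \<times> {l. is_partition l}. R x} = surplus_words k C"
    by (auto simp: R_def surplus_words_def)
  ultimately show ?thesis using eqpoll_trans[OF eqpoll_sym[OF 1]] 2 by simp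
qed

lemma measured_times_bounded_msets:
  "{(S, y). S \<in> {S. finite S \<and> 0 \<notin> S} \<and> y \<in> bounded_msets \<and>
      C (separation k S + fst y) (\<Sum>S + residue_defect k (residues k S) + k * \<Sum>\<^sub># (snd y)) (residues k S)}
    \<approx> measured k 1 1 (\<lambda>m n a. C m (n + residue_defect k a) a)"
proof (rule eqpoll_byWitness[where f = "\<lambda>(S, M, E). (M, E, S)" and g = "\<lambda>(M, E, S). (S, M, E)"])
  have *: "S \<subseteq> {1..} \<longleftrightarrow> 0 \<notin> S" for S :: "nat set" by (auto simp: Suc_le_eq intro: gr0I)
  have **: "S \<inter> {1..} = S" if "0 \<notin> S" for S :: "nat set" using *[of S] that by blast
  have sum: "\<Sum>S + residue_defect k (residues k S) + k * \<Sum>\<^sub># E = k * \<Sum>\<^sub># E + \<Sum>S + residue_defect k (residues k S)"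
    for S E by simp
  show "(case x of (S, M, E) \<Rightarrow> (M, E, S)) \<in> measured k 1 1 (\<lambda>m n a. C m (n + residue_defect k a) a)"
    if "x \<in> {(S, y). S \<in> {S. finite S \<and> 0 \<notin> S} \<and> y \<in> bounded_msets \<and>
      C (separation k S + fst y) (\<Sum>S + residue_defect k (residues k S) + k * \<Sum>\<^sub># (snd y)) (residues k S)}" for x
    using that unfolding measured_def bounded_msets_def sum by (clarsimp simp: * ** simp del: One_nat_def)
  show "(case x of (M, E, S) \<Rightarrow> (S, M, E)) \<in> {(S, y). S \<in> {S. finite S \<and> 0 \<notin> S} \<and> y \<in> bounded_msets \<and>
      C (separation k S + fst y) (\<Sum>S + residue_defect k (residues k S) + k * \<Sum>\<^sub># (snd y)) (residues k S)}"
    if "x \<in> measured k 1 1 (\<lambda>m n a. C m (n + residue_defect k a) a)" for x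
    using that unfolding measured_def bounded_msets_def sum by (clarsimp simp: * ** simp del: One_nat_def)
qed auto

text \<open>
  Both products with the surplus pairs are equipollent to the windowed triples with \<open>p = b = 1\<close>, so the
  surplus pairs can be cancelled.
\<close>
lemma eqpoll_sets_words:
  assumes k: "k \<ge> 1"
  shows "{S \<in> {S. finite S \<and> 0 \<notin> S}. separation k S = m \<and> \<Sum>S + residue_defect k (residues k S) = n \<and> residues k S = c}
    \<approx> {w \<in> words (k + 1). asc_beta (k + 1) w = m \<and> k * comaj_beta (k + 1) w = n \<and> word_residues k w = c}"
proof (rule eqpoll_cancel_surplus[where Y = bounded_msets and z = "(0, {#})" and \<mu> = fst and \<nu> = "\<lambda>y. k * \<Sum>\<^sub># (snd y)"])
  show "finite {y \<in> bounded_msets. fst y \<le> m \<and> k * \<Sum>\<^sub># (snd y) \<le> n}" for m n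
  proof (rule finite_subset)
    show "{y \<in> bounded_msets. fst y \<le> m \<and> k * \<Sum>\<^sub># (snd y) \<le> n} \<subseteq>
        {..m} \<times> {E. set_mset E \<subseteq> {1..m} \<and> \<Sum>\<^sub># E \<le> n}"
    proof
      fix y assume y: "y \<in> {y \<in> bounded_msets. fst y \<le> m \<and> k * \<Sum>\<^sub># (snd y) \<le> n}"
      obtain M E where ME: "y = (M, E)" by (cases y)
      have *: "(M, E) \<in> bounded_msets" "fst (M, E) \<le> m" "k * \<Sum>\<^sub># (snd (M, E)) \<le> n"
        using y ME by simp_all
      have "\<Sum>\<^sub># E \<le> k * \<Sum>\<^sub># E" using k by simp
      also have "\<dots> \<le> n" using *(3) by simp
      finally have "\<Sum>\<^sub># E \<le> n" .
      moreover have "set_mset E \<subseteq> {1..m}" using *(1,2) by (force simp: bounded_msets_def)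
      ultimately show "y \<in> {..m} \<times> {E. set_mset E \<subseteq> {1..m} \<and> \<Sum>\<^sub># E \<le> n}"
        using *(2) ME by simp
    qed
    show "finite ({..m} \<times> {E. set_mset E \<subseteq> {1..m} \<and> \<Sum>\<^sub># E \<le> n})"
      using finite_bounded_msets by simp
  qed
  show "(0, {#}) \<in> bounded_msets" "fst (0, {#}) = 0" "k * \<Sum>\<^sub># (snd (0, {#})) = 0"
    by (simp_all add: bounded_msets_def)
  show "y = (0, {#})" if "y \<in> bounded_msets" "fst y = 0" for y
    using that by (cases y) (auto simp: bounded_msets_def)
  show "finite {S \<in> {S. finite S \<and> 0 \<notin> S}. separation k S = m \<and>
      \<Sum>S + residue_defect k (residues k S) = n \<and> residues k S = c}" for m n c
  proof (rule finite_subset)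
    show "{S \<in> {S. finite S \<and> 0 \<notin> S}. separation k S = m \<and>
      \<Sum>S + residue_defect k (residues k S) = n \<and> residues k S = c} \<subseteq> Pow {..n}"
    proof
      fix S assume S: "S \<in> {S \<in> {S. finite S \<and> 0 \<notin> S}. separation k S = m \<and>
        \<Sum>S + residue_defect k (residues k S) = n \<and> residues k S = c}"
      have "s \<le> n" if "s \<in> S" for s
        using member_le_sum[of s S "\<lambda>x. x"] that S by auto
      then show "S \<in> Pow {..n}" by auto
    qed
  qed simp
  show "{(S, y). S \<in> {S. finite S \<and> 0 \<notin> S} \<and> y \<in> bounded_msets \<and> separation k S + fst y = m \<and>
        \<Sum>S + residue_defect k (residues k S) + k * \<Sum>\<^sub># (snd y) = n \<and> residues k S = c} \<approx>
      {(w, y). w \<in> words (k + 1) \<and> y \<in> bounded_msets \<and> asc_beta (k + 1) w + fst y = m \<and>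
        k * comaj_beta (k + 1) w + k * \<Sum>\<^sub># (snd y) = n \<and> word_residues k w = c}" for m n c
  proof -
    let ?C = "\<lambda>m' n' a'. m' = m \<and> n' = n \<and> a' = c"
    let ?C' = "\<lambda>m n a. ?C m (n + residue_defect k a) a"
    have "windowed k 1 1 ?C' \<approx> measured k 1 1 ?C'"
      by (rule windowed_eqpoll_measured[OF k, where N = n]) auto
    then have "measured k 1 1 ?C' \<approx> semistrict_msets k ?C"
      using windowed_eqpoll_semistrict_msets[OF k, of ?C] by (meson eqpoll_sym eqpoll_trans)
    moreover have "surplus_words k ?C \<approx> semistrict_msets k ?C"
      using eqpoll_trans[OF eqpoll_trans[OF surplus_words_eqpoll_levelled_words
        levelled_words_eqpoll_semistrict_partitions] semistrict_partitions_eqpoll_semistrict_msets] .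
    ultimately have "measured k 1 1 ?C' \<approx> surplus_words k ?C"
      by (meson eqpoll_sym eqpoll_trans)
    then show ?thesis
      using measured_times_bounded_msets[of ?C k] words_times_bounded_msets[of k ?C]
      by (meson eqpoll_sym eqpoll_trans)
  qed
qed

section \<open>The bijection\<close>

lemma count_eq_size_filter: "count A x = size {#y \<in># A. y = x#}"
  by (metis filter_eq_replicate_mset size_replicate_mset)

lemma count_word_residues:
  assumes "w \<in> words (k + 1)" "i \<in> {1..k}"
  shows "count (word_residues k w) (i mod k) = count_list w i"
proof -
  have mod_iff: "c mod k = i mod k \<longleftrightarrow> c = i" if "c \<in> {1..k}" for c
  proof
    assume eq: "c mod k = i mod k"
    have "x mod k = (if x = k then 0 else x)" if "x \<in> {1..k}" for x using that by auto
    from this[OF that] this[OF assms(2)] eq that assms(2) show "c = i" by (auto split: if_splits)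
  qed simp
  have mem: "c \<in> {1..k + 1}" if "c \<in># mset w" for c using wordsD(2)[OF assms(1)] that by auto
  have "count (word_residues k w) (i mod k) =
      size {#c \<in># mset w. c \<noteq> k + 1 \<and> c mod k = i mod k#}"
    unfolding word_residues_def count_eq_size_filter
    by (simp add: filter_mset_image_mset filter_filter_mset conj_commute)
  also have "{#c \<in># mset w. c \<noteq> k + 1 \<and> c mod k = i mod k#} = {#c \<in># mset w. c = i#}"
  proof (rule filter_mset_cong[OF refl])
    fix c assume "c \<in># mset w"
    then show "(c \<noteq> k + 1 \<and> c mod k = i mod k) = (c = i)"
      using mem[of c] mod_iff[of c] assms(2) by (cases "c = k + 1") auto
  qed
  also have "size \<dots> = count_list w i" by (simp add: filter_eq_replicate_mset count_mset)
  finally show ?thesis .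
qed

lemma defect_word_residues:
  assumes "w \<in> words (k + 1)" "k \<ge> 1"
  shows "residue_defect k (word_residues k w) = (\<Sum>i = 1..k - 1. (k - i) * count_list w i)"
proof -
  let ?d = "\<lambda>r. if r = 0 then 0 else k - r"
  let ?f = "\<lambda>c. if c \<noteq> k + 1 then ?d (c mod k) else 0"
  have "residue_defect k (word_residues k w) = (\<Sum>c\<in>#filter_mset (\<lambda>c. c \<noteq> k + 1) (mset w). ?d (c mod k))"
    by (simp add: residue_defect_def word_residues_def multiset.map_comp comp_def)
  also have "\<dots> = sum_list (map ?f w)"
    by (induction w) auto
  also have "\<dots> = (\<Sum>c\<in>{1..k + 1}. count_list w c * ?f c)"
    using wordsD(2)[OF assms(1)] by (intro sum_list_map_eq_sum_count2) auto
  also have "\<dots> = (\<Sum>c\<in>{1..k - 1}. count_list w c * ?f c)"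
  proof (rule sum.mono_neutral_right)
    show "\<forall>c\<in>{1..k + 1} - {1..k - 1}. count_list w c * ?f c = 0"
    proof
      fix c assume "c \<in> {1..k + 1} - {1..k - 1}"
      then have "c = k \<or> c = k + 1" by auto
      then show "count_list w c * ?f c = 0" by auto
    qed
  qed auto
  also have "\<dots> = (\<Sum>i = 1..k - 1. (k - i) * count_list w i)"
  proof (rule sum.cong[OF refl])
    fix c assume "c \<in> {1..k - 1}"
    then have "c mod k = c" "c \<noteq> 0" "c \<noteq> k + 1" using assms(2) by auto
    then show "count_list w c * ?f c = (k - c) * count_list w c" by simp
  qed
  finally show ?thesis .
qed

lemma count_residues_parts:
  assumes "l \<in> distinct_partitions"
  shows "count (residues k (parts l)) (i mod k) = card {j \<in> part_indices l. [l j = i] (mod k)}"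
proof -
  have fin: "finite (part_indices l)" using assms by (simp add: distinct_partitions_def is_partition_def)
  have "residues k (parts l) = image_mset (\<lambda>j. l j mod k) (mset_set (part_indices l))"
    unfolding residues_def parts_mset_distinct[OF assms, symmetric] parts_mset_def
    by (simp add: multiset.map_comp comp_def)
  then show ?thesis
    using fin by (simp add: count_eq_size_filter filter_mset_image_mset cong_def)
qed

theorem theorem1p8:
  fixes k :: nat
  assumes "k \<ge> 1"
  shows "\<exists>\<Omega> :: (nat \<Rightarrow> nat) \<Rightarrow> nat list.
    bij_betw \<Omega> distinct_partitions (words (k + 1)) \<and>
    (\<forall>l \<in> distinct_partitions.
      (\<forall>i \<in> {1..k}. card {j \<in> part_indices l. [l j = i] (mod k)} = count_list (\<Omega> l) i) \<and>
      int (psize l) = int k * int (comaj_beta (k + 1) (\<Omega> l))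
        - (\<Sum>i = 1..k - 1. (int k - int i) * int (count_list (\<Omega> l) i)) \<and>
      k_measure k l = asc_beta (k + 1) (\<Omega> l))"
proof -
  let ?u = "\<lambda>S. (separation k S, \<Sum>S + residue_defect k (residues k S), residues k S)"
  let ?v = "\<lambda>w. (asc_beta (k + 1) w, k * comaj_beta (k + 1) w, word_residues k w)"
  have "{S \<in> {S. finite S \<and> 0 \<notin> S}. ?u S = c} \<approx> {w \<in> words (k + 1). ?v w = c}" for c
    using eqpoll_sets_words[OF assms] by (cases c) simp
  from bij_of_eqpoll_fibres[of "{S. finite S \<and> 0 \<notin> S}" ?u "words (k + 1)" ?v, OF this]
  obtain f where f: "bij_betw f {S. finite S \<and> 0 \<notin> S} (words (k + 1))"
    and weight: "\<And>S. finite S \<Longrightarrow> 0 \<notin> S \<Longrightarrow> ?v (f S) = ?u S" by auto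
  let ?\<Omega> = "f \<circ> parts"
  have bij: "bij_betw ?\<Omega> distinct_partitions (words (k + 1))"
    by (rule bij_betw_trans[OF bij_parts f])
  moreover have "(\<forall>i \<in> {1..k}. card {j \<in> part_indices l. [l j = i] (mod k)} = count_list (?\<Omega> l) i) \<and>
      int (psize l) = int k * int (comaj_beta (k + 1) (?\<Omega> l))
        - (\<Sum>i = 1..k - 1. (int k - int i) * int (count_list (?\<Omega> l) i)) \<and>
      k_measure k l = asc_beta (k + 1) (?\<Omega> l)" if l: "l \<in> distinct_partitions" for l
  proof -
    have S: "finite (parts l)" "0 \<notin> parts l" using bij_betwE[OF bij_parts] l by auto
    let ?w = "f (parts l)"
    have w: "?w \<in> words (k + 1)" using bij_betwE[OF f] S by blast
    have asc: "asc_beta (k + 1) ?w = separation k (parts l)"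
      and comaj: "k * comaj_beta (k + 1) ?w = \<Sum>(parts l) + residue_defect k (residues k (parts l))"
      and res: "word_residues k ?w = residues k (parts l)"
      using weight[OF S] by auto
    have size: "\<Sum>(parts l) = psize l"
      using sum_parts_mset[of l] S(1) unfolding parts_mset_distinct[OF l] by (simp add: sum_unfold_sum_mset)
    have "int k * int (comaj_beta (k + 1) ?w) = int (psize l + (\<Sum>i = 1..k - 1. (k - i) * count_list ?w i))"
      using comaj defect_word_residues[OF w assms] unfolding size res by (metis of_nat_mult)
    also have "\<dots> = int (psize l) + (\<Sum>i = 1..k - 1. (int k - int i) * int (count_list ?w i))"
      unfolding of_nat_add of_nat_sum of_nat_mult
      by (intro arg_cong2[where f = "(+)"] refl sum.cong) (auto simp: of_nat_diff)
    finally show ?thesis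
      using count_word_residues[OF w] count_residues_parts[OF l] res asc k_measure_eq_separation[OF l assms]
      by simp
  qed
  ultimately show ?thesis by blast
qed

end
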